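(* Let $W:[0,1]^2\to[0,\infty)$ be bounded and measurable, and let $c:\mathbb N_0\times\mathbb N_0\to[0,\infty)$ satisfy $c(0,\ell)=0$ for all $\ell\ge0$, $c(k,\ell)>0$ for all $k>0$, $\ell\ge0$, and $c(k,\ell)\le C_c\,k(1+\ell)$ for all $k,\ell\in\mathbb N_0$ and some constant $C_c>0$. Let $T>0$ and let $(\mu_t)_{t\in[0,T]}$ and $(\nu_t)_{t\in[0,T]}$ be two weak solutions (in the sense of the context) of the graphon master equation with kernel $W$ and rates $c$, such that for some constant $M_T<\infty$ $$\int_{[0,1]\times\mathbb N_0}k\,\mu_t(du,dk)<M_T,\qquad\int_{[0,1]\times\mathbb N_0}k\,\nu_t(du,dk)<M_T\qquad\text{for all }t\in[0,T],$$ and $$\int_{[0,1]\times\mathbb N_0}k^2\,\mu_0(du,dk)<\infty,\qquad\int_{[0,1]\times\mathbb N_0}k^2\,\nu_0(du,dk)<\infty.$$ For $k\ge0$ write $\mu_t^k(du):=\mu_t(du,\{k\})$, $\nu_t^k(du):=\nu_t(du,\{k\})$, $\Delta_t^k:=\mu_t^k-\nu_t^k$ (a finite signed measure on $[0,1]$ with total variation measure $|\Delta_t^k|$), and define $$\Theta(t):=\sum_{k\ge0}(1+k)\,|\Delta_t^k|([0,1]).$$ Then there exists a constant $C_T>0$ such that $$\Theta(t)\le e^{C_Tt}\,\Theta(0),\qquad t\in[0,T].$$ In particular, if $\mu_0=\nu_0$, then $\mu_t=\nu_t$ for every $t\in[0,T]$.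
   Context: $\mathbb N_0=\{0,1,2,\dots\}$ with the discrete topology, $C_b$ denotes bounded continuous functions, and $\langle\mu,\varphi\rangle=\int\varphi\,d\mu$. A weak solution on $[0,T]$ of the graphon master equation with kernel $W$ and rates $c$ is a (measurable in $t$) family $(\mu_t)_{t\in[0,T]}$ of probability measures on $[0,1]\times\mathbb N_0$ such that for every $\varphi\in C_b([0,1]\times\mathbb N_0)$ and every $t\in[0,T]$ $$\langle\mu_t,\varphi\rangle=\langle\mu_0,\varphi\rangle+\int_0^t\iint_{([0,1]\times\mathbb N_0)^2}W(u,v)\,c(k,\ell)\,G_\varphi((u,k),(v,\ell))\,\mu_s(du,dk)\,\mu_s(dv,d\ell)\,ds,$$ where $G_\varphi((u,k),(v,\ell)):=\varphi(u,k-1)-\varphi(u,k)+\varphi(v,\ell+1)-\varphi(v,\ell)$, with the convention $\varphi(u,-1):=0$. The constant $C_T$ may depend on $T$ and on the solutions. *)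

theory Defs
  imports "HOL-Probability.Probability"
begin

text \<open>The spaces $[0,1]$ and $[0,1] \times \mathbb{N}_0$ are
  represented by measurable spaces whose carriers are the corresponding subsets.\<close>

definition unit_borel :: "real measure" where
  "unit_borel = restrict_space borel {0..1}"

definition state_space :: "(real \<times> nat) measure" where
  "state_space = unit_borel \<Otimes>\<^sub>M count_space UNIV"

text \<open>The topology on \<^typ>\<open>nat\<close> is the discrete one; only the values on
  $[0,1] \times \mathbb{N}_0$ matter.\<close>

definition test_functions :: "(real \<times> nat \<Rightarrow> real) set" where
  "test_functions = {\<phi>. continuous_on ({0..1} \<times> UNIV) \<phi> \<and> bounded (\<phi> ` ({0..1} \<times> UNIV))}"

definition jump :: "(real \<times> nat \<Rightarrow> real) \<Rightarrow> real \<times> nat \<Rightarrow> real \<times> nat \<Rightarrow> real" where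
  "jump \<phi> = (\<lambda>(u, k) (v, l).
     (if k = 0 then 0 else \<phi> (u, k - 1)) - \<phi> (u, k) + \<phi> (v, l + 1) - \<phi> (v, l))"

definition rate_integrand ::
  "(real \<Rightarrow> real \<Rightarrow> real) \<Rightarrow> (nat \<Rightarrow> nat \<Rightarrow> real) \<Rightarrow> (real \<times> nat \<Rightarrow> real)
     \<Rightarrow> (real \<times> nat) \<times> (real \<times> nat) \<Rightarrow> real" where
  "rate_integrand W c \<phi> = (\<lambda>(x, y). W (fst x) (fst y) * c (snd x) (snd y) * jump \<phi> x y)"

text \<open>Measurability in time is measurability as a map into the space of probability measures
  on the state space, i.e. measurability of $t \mapsto \mu_t(A)$ for every measurable $A$.
  The two integrability clauses make explicit that the integrals in the equation exist; the
  Bochner integral would otherwise default to 0. They are automatic for bounded measurable $W$,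
  $c(k,\ell) \le C k (1 + \ell)$ and uniformly bounded first moments.\<close>

definition weak_solution ::
  "(real \<Rightarrow> real \<Rightarrow> real) \<Rightarrow> (nat \<Rightarrow> nat \<Rightarrow> real) \<Rightarrow> real \<Rightarrow> (real \<Rightarrow> (real \<times> nat) measure) \<Rightarrow> bool"
where
  "weak_solution W c T \<mu> \<longleftrightarrow>
     \<mu> \<in> restrict_space borel {0..T} \<rightarrow>\<^sub>M prob_algebra state_space \<and>
     (\<forall>\<phi> \<in> test_functions. \<forall>t \<in> {0..T}.
        (AE s in lborel. s \<in> {0..t} \<longrightarrow> integrable (\<mu> s \<Otimes>\<^sub>M \<mu> s) (rate_integrand W c \<phi>)) \<and>
        set_integrable lborel {0..t} (\<lambda>s. \<integral>z. rate_integrand W c \<phi> z \<partial>(\<mu> s \<Otimes>\<^sub>M \<mu> s)) \<and>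
        (\<integral>x. \<phi> x \<partial>\<mu> t) = (\<integral>x. \<phi> x \<partial>\<mu> 0) +
          (LINT s:{0..t}|lborel. (\<integral>z. rate_integrand W c \<phi> z \<partial>(\<mu> s \<Otimes>\<^sub>M \<mu> s))))"

text \<open>Total variation $|\Delta|(E)$ of a signed measure $\Delta$ on the measurable space \<open>S\<close>:
  the supremum over countable measurable partitions of \<open>E\<close>. Signed measures are represented
  by real set functions, of which only the values on \<open>sets S\<close> are used.\<close>

definition total_variation :: "'a measure \<Rightarrow> ('a set \<Rightarrow> real) \<Rightarrow> 'a set \<Rightarrow> ennreal" where
  "total_variation S \<Delta> E =
     (SUP A \<in> {A :: nat \<Rightarrow> 'a set. range A \<subseteq> sets S \<and> disjoint_family A \<and> (\<Union>i. A i) = E}.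
        \<Sum>i. ennreal \<bar>\<Delta> (A i)\<bar>)"

definition slice_diff :: "(real \<times> nat) measure \<Rightarrow> (real \<times> nat) measure \<Rightarrow> nat \<Rightarrow> real set \<Rightarrow> real"
where
  "slice_diff M N k A = measure M (A \<times> {k}) - measure N (A \<times> {k})"

text \<open>The series is taken in $[0,\infty]$; its value is finite when both measures are probability
  measures with finite first moment.\<close>

definition Theta ::
  "(real \<Rightarrow> (real \<times> nat) measure) \<Rightarrow> (real \<Rightarrow> (real \<times> nat) measure) \<Rightarrow> real \<Rightarrow> ennreal" where
  "Theta \<mu> \<nu> t =
     (\<Sum>k. ennreal (1 + real k) * total_variation unit_borel (slice_diff (\<mu> t) (\<nu> t) k) {0..1})"

end

theory Submission
  imports Defs
begin

text \<open>Write $w(u,k) = 1 + k$ and $\Delta_t = \mu_t - \nu_t$. The jump kernel is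
  $R((u,k),(v,\ell)) = W(u,v)\,c(k,\ell) \le \Lambda\,k\,w(v,\ell)$, and the equation for $\mu$ is that
  of a birth-death chain whose jump rates are the averages of $R$ over $\mu_t$ itself. By a
  monotone class argument the weak equation holds for all bounded measurable test functions.
  Testing with $\min(k,N)^2$ propagates the second moment, which makes
  $t \mapsto \mu_t$ Lipschitz in the $w$-weighted total variation norm.

  Let $\sigma_t$ be the sign of $\Delta_t$, so that
  $\Theta(t) = \langle \Delta_t, \sigma_t w \rangle$. For the compactly supported weights
  $w_K(k) = \min(1+k, (K-k)^+)$ put $\psi = \sigma_{t+h} w_K$, so that
  $\Theta_K(t+h) = \langle \Delta_{t+h}, \psi \rangle$. One Euler step of the linearised equation
  replaces $\psi$ by $\psi + h P_t \psi$; for $h$ small (depending on $K$) this is a positive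
  operator and, since $w_K$ is 1-Lipschitz in $k$ and the rates are at most linear,
  $|\psi + h P_t \psi| \le w_K + h C_1 w$: the quadratically growing terms that a direct
  estimate would produce do not appear. The remaining part of the nonlinearity is bounded by the
  second moment of $\nu$ times $\Theta(t)$. This gives
  $\Theta_K(t+h) \le \Theta_K(t) + C h \Theta(t) + c_K h^2$; summing over small steps and letting
  $h \to 0$, then $K \to \infty$, yields $\Theta(t) \le \Theta(0) + C \int_0^t \Theta$.\<close>

section \<open>Gronwall inequality from increments\<close>

text \<open>A direct estimate fails because increments of \<sigma> w are of order w and so are the
  rates: the integral of w^2 against the total variation of \<Delta>_t is finite, but \<Theta>(t)
  does not control it. Positivity of the Euler step recovers one power of w: the neighbouring values
  enter with the same mass that is removed from the centre, so only differences of w_K survive. In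
  the other half of the nonlinearity the quadratic weight is integrated against \<nu>_t alone. Hence
  the second moment of \<nu> enters the growth constant, while those of both solutions enter the
  time-Lipschitz constants, which only affect terms of order h^2. The sign is frozen at the end t +
  h of a step, where testing is exact; at time t a foreign sign can only lower the value, so no
  regularity of t \<mapsto> \<sigma>_t is asked for.\<close>

lemma quadratic_increments_imp_le:
  fixes G :: "real \<Rightarrow> real"
  assumes incr: "\<And>t h. 0 \<le> t \<Longrightarrow> 0 \<le> h \<Longrightarrow> h \<le> h\<^sub>0 \<Longrightarrow> t + h \<le> T \<Longrightarrow> G (t + h) \<le> G t + c * h\<^sup>2"
    and "0 < h\<^sub>0" "t \<in> {0..T}"
  shows "G t \<le> G 0"
proof -
  \<comment> \<open>With n equal steps of length t / n the accumulated error is n * c * (t / n)^2 =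
    c * t^2 / n.\<close>
  have ev: "\<forall>\<^sub>F n in sequentially. G t \<le> G 0 + c * t\<^sup>2 * inverse (real n)"
  proof (rule eventually_sequentiallyI)
    fix n :: nat assume n: "n \<ge> nat \<lceil>t / h\<^sub>0\<rceil> + 1"
    then have n0: "0 < real n" by simp
    have "t / h\<^sub>0 \<le> real n" using n by linarith
    then have small: "t / n \<le> h\<^sub>0" using assms(2) n0 by (simp add: field_simps)
    have "i \<le> n \<Longrightarrow> G (i * (t / n)) \<le> G 0 + i * (c * (t / n)\<^sup>2)" for i
    proof (induction i)
      case (Suc i)
      have "real (Suc i) * (t / n) \<le> n * (t / n)"
        using Suc.prems assms(3) by (intro mult_right_mono) auto
      moreover have "real n * (t / n) = t" "real (Suc i) * (t / n) = i * (t / n) + t / n"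
        using n0 by (auto simp: algebra_simps add_divide_distrib)
      ultimately have "i * (t / n) + t / n \<le> T" using assms(3) by simp
      then have "G (i * (t / n) + t / n) \<le> G (i * (t / n)) + c * (t / n)\<^sup>2"
        using small assms(3) by (intro incr) auto
      moreover have "real (Suc i) * (t / n) = i * (t / n) + t / n" by (simp add: algebra_simps add_divide_distrib)
      ultimately show ?case using Suc by (simp add: algebra_simps del: times_divide_eq_right)
    qed simp
    from this[of n] show "G t \<le> G 0 + c * t\<^sup>2 * inverse (real n)"
      using n0 by (simp add: power2_eq_square field_simps)
  qed
  have "(\<lambda>n. G 0 + c * t\<^sup>2 * inverse (real n)) \<longlonglongrightarrow> G 0 + c * t\<^sup>2 * 0"
    by (intro tendsto_intros lim_inverse_n)
  then show ?thesis using ev by (intro tendsto_lowerbound[OF _ ev]) auto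
qed

text \<open>The product of A + C \<integral> f with exp (- C t) has derivative - C exp (- C s) (A +
  C \<integral> f - f s) \<le> 0, so it stays below its initial value A.\<close>

lemma gronwall_integral:
  fixes f :: "real \<Rightarrow> real"
  assumes cont: "continuous_on {0..T} f" and "0 \<le> C"
    and le: "\<And>t. t \<in> {0..T} \<Longrightarrow> f t \<le> A + C * integral {0..t} f"
    and t: "t \<in> {0..T}"
  shows "f t \<le> A * exp (C * t)"
proof -
  define g where "g t = (A + C * integral {0..t} f) * exp (- C * t)" for t
  have "g t \<le> g 0"
  proof (rule DERIV_nonpos_imp_decreasing_open[of 0 t])
    show "0 \<le> t" using t by simp
    fix s assume s: "0 < s" "s < t"
    then have sT: "s \<in> {0..T}" using t by auto
    have "((\<lambda>t. integral {0..t} f) has_vector_derivative f s) (at s within {0..T})"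
      by (rule integral_has_vector_derivative[OF cont sT])
    then have d: "((\<lambda>t. integral {0..t} f) has_real_derivative f s) (at s)"
      unfolding has_real_derivative_iff_has_vector_derivative
      using at_within_interior[of s "{0..T}"] s t by simp
    have "(g has_real_derivative
        (C * f s) * exp (- C * s) + (A + C * integral {0..s} f) * (exp (- C * s) * (- C))) (at s)"
    proof -
      have e: "((\<lambda>t. exp (- C * t)) has_real_derivative exp (- C * s) * (- C)) (at s)"
        by (auto intro!: derivative_eq_intros)
      have i: "((\<lambda>t. A + C * integral {0..t} f) has_real_derivative C * f s) (at s)"
        using DERIV_add[OF DERIV_const[of A] DERIV_cmult[OF d, of C]] by simp
      show ?thesis
        unfolding g_def[abs_def] by (rule DERIV_cong[OF DERIV_mult'[OF i e]]) (simp add: algebra_simps)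
    qed
    moreover have "(C * f s) * exp (- C * s) + (A + C * integral {0..s} f) * (exp (- C * s) * (- C))
       = - (C * exp (- C * s)) * (A + C * integral {0..s} f - f s)"
      by (simp add: algebra_simps)
    moreover have "\<dots> \<le> 0"
      using le[OF sT] \<open>0 \<le> C\<close> by (intro mult_nonpos_nonneg) auto
    ultimately show "\<exists>y. (g has_real_derivative y) (at s) \<and> y \<le> 0" by metis
  next
    have "f integrable_on {0..T}" by (rule integrable_continuous_real[OF cont])
    then have "f integrable_on {0..t}" using t by (auto intro: integrable_subinterval_real)
    then show "continuous_on {0..t} g"
      unfolding g_def by (intro continuous_intros indefinite_integral_continuous_1)
  qed
  then have "A + C * integral {0..t} f \<le> A * exp (C * t)"
    by (simp add: g_def exp_minus field_simps)
  with le[OF t] show ?thesis by linarith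
qed

text \<open>Adapted to truncation: the linear term already carries the limit \<open>f\<close>, while
  the step size and the quadratic constant may depend on \<open>K\<close>. At fixed \<open>K\<close>
  the step tends to 0, which removes the quadratic term; \<open>K\<close> goes to infinity only in
  the resulting integral inequality.\<close>

lemma gronwall_increments:
  fixes f :: "real \<Rightarrow> real" and F :: "nat \<Rightarrow> real \<Rightarrow> real"
  assumes "0 \<le> C"
    and lip: "\<And>s t. s \<in> {0..T} \<Longrightarrow> t \<in> {0..T} \<Longrightarrow> \<bar>f s - f t\<bar> \<le> L * \<bar>s - t\<bar>"
    and incr: "\<And>K. \<exists>c h\<^sub>0. 0 < h\<^sub>0 \<and> (\<forall>t h. 0 \<le> t \<longrightarrow> 0 \<le> h \<longrightarrow> h \<le> h\<^sub>0 \<longrightarrow> t + h \<le> T \<longrightarrow>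
                  F K (t + h) \<le> F K t + C * h * f t + c * h\<^sup>2)"
    and lim: "\<And>t. t \<in> {0..T} \<Longrightarrow> (\<lambda>K. F K t) \<longlonglongrightarrow> f t"
    and t: "t \<in> {0..T}"
  shows "f t \<le> f 0 * exp (C * t)"
proof -
  have "\<bar>f s - f t\<bar> \<le> \<bar>L\<bar> * \<bar>s - t\<bar>" if "s \<in> {0..T}" "t \<in> {0..T}" for s t
    using lip[OF that] by (rule order_trans) (auto intro: mult_right_mono)
  then have "\<bar>L\<bar>-lipschitz_on {0..T} f"
    by (intro lipschitz_onI) (auto simp: dist_real_def)
  then have cont: "continuous_on {0..T} f"
    by (rule lipschitz_on_continuous_on)
  have int: "f integrable_on {a..b}" if "0 \<le> a" "b \<le> T" for a b
    using integrable_continuous_real[OF cont] that by (auto intro: integrable_subinterval_real)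
  have "f s \<le> f 0 + C * integral {0..s} f" if s: "s \<in> {0..T}" for s
  proof (rule LIMSEQ_le)
    show "(\<lambda>K. F K s) \<longlonglongrightarrow> f s" by (rule lim[OF s])
    show "(\<lambda>K. F K 0 + C * integral {0..s} f) \<longlonglongrightarrow> f 0 + C * integral {0..s} f"
      using s by (intro tendsto_intros lim) auto
    have "F K s \<le> F K 0 + C * integral {0..s} f" for K
    proof -
      obtain c h\<^sub>0 where h0: "0 < h\<^sub>0"
        and incrK: "\<And>t h. 0 \<le> t \<Longrightarrow> 0 \<le> h \<Longrightarrow> h \<le> h\<^sub>0 \<Longrightarrow> t + h \<le> T \<Longrightarrow>
                  F K (t + h) \<le> F K t + C * h * f t + c * h\<^sup>2"
        using incr[of K] by metis
      \<comment> \<open>By Lipschitz continuity h * f r exceeds the integral of \<open>f\<close>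
        over [r, r + h] by at most |L| * h^2, so subtracting the integral leaves purely quadratic
        increments.\<close>
      define G where "G s = F K s - C * integral {0..s} f" for s
      have "G s \<le> G 0"
      proof (rule quadratic_increments_imp_le[where c = "c + C * \<bar>L\<bar>", OF _ h0 s])
        fix r h :: real assume rh: "0 \<le> r" "0 \<le> h" "h \<le> h\<^sub>0" "r + h \<le> T"
        have "integral {r..r + h} (\<lambda>_. f r - \<bar>L\<bar> * h) \<le> integral {r..r + h} f"
        proof (rule integral_le)
          fix x assume x: "x \<in> {r..r + h}"
          then have "\<bar>f r - f x\<bar> \<le> L * \<bar>r - x\<bar>" using rh by (intro lip) auto
          also have "\<dots> \<le> \<bar>L\<bar> * h" using x by (intro mult_mono) auto
          finally show "f r - \<bar>L\<bar> * h \<le> f x" by linarith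
        qed (use rh int in auto)
        moreover have "integral {0..r + h} f = integral {0..r} f + integral {r..r + h} f"
          using Henstock_Kurzweil_Integration.integral_combine[of 0 r "r + h" f] int[of 0 "r + h"] rh
          by simp
        ultimately have "C * (h * (f r - \<bar>L\<bar> * h)) \<le> C * (integral {0..r + h} f - integral {0..r} f)"
          using \<open>0 \<le> C\<close> rh by (intro mult_left_mono) auto
        with incrK[OF rh] show "G (r + h) \<le> G r + (c + C * \<bar>L\<bar>) * h\<^sup>2"
          by (simp add: G_def algebra_simps power2_eq_square)
      qed
      then show ?thesis by (simp add: G_def)
    qed
    then show "\<exists>N. \<forall>n\<ge>N. F n s \<le> F n 0 + C * integral {0..s} f" by blast
  qed
  from gronwall_integral[OF cont \<open>0 \<le> C\<close> this t] show ?thesis .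
qed

section \<open>The jump kernel\<close>

definition lose :: "(real \<times> nat \<Rightarrow> real) \<Rightarrow> real \<times> nat \<Rightarrow> real" where
  "lose \<phi> x = (if snd x = 0 then 0 else \<phi> (fst x, snd x - 1)) - \<phi> x"

definition gain :: "(real \<times> nat \<Rightarrow> real) \<Rightarrow> real \<times> nat \<Rightarrow> real" where
  "gain \<phi> x = \<phi> (fst x, snd x + 1) - \<phi> x"

definition wt :: "real \<times> nat \<Rightarrow> real" where
  "wt x = 1 + real (snd x)"

lemma jump_eq: "jump \<phi> x y = lose \<phi> x + gain \<phi> y"
  by (auto simp: jump_def lose_def gain_def split: prod.splits)

lemma wt_ge_1: "1 \<le> wt x"
  by (simp add: wt_def)

lemma space_state_space: "space state_space = {0..1} \<times> UNIV"
  by (simp add: state_space_def unit_borel_def space_pair_measure)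

lemma shift_measurable [measurable]: "(\<lambda>x. (fst x, f (snd x))) \<in> state_space \<rightarrow>\<^sub>M state_space"
  unfolding state_space_def by measurable

lemma snd_measurable [measurable]: "snd \<in> state_space \<rightarrow>\<^sub>M count_space UNIV"
  unfolding state_space_def by measurable

lemma fst_measurable [measurable]: "fst \<in> state_space \<rightarrow>\<^sub>M unit_borel"
  unfolding state_space_def by measurable

lemma wt_measurable [measurable]: "wt \<in> borel_measurable state_space"
  unfolding wt_def by measurable

lemma comp_shift_measurable [measurable (raw)]:
  "\<phi> \<in> borel_measurable state_space \<Longrightarrow> (\<lambda>x. \<phi> (fst x, f (snd x))) \<in> borel_measurable state_space"
  by (rule measurable_compose[OF shift_measurable])

lemma gain_measurable [measurable (raw)]:
  "\<phi> \<in> borel_measurable state_space \<Longrightarrow> gain \<phi> \<in> borel_measurable state_space"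
  unfolding gain_def by (auto intro!: borel_measurable_diff comp_shift_measurable)

lemma lose_measurable [measurable (raw)]:
  assumes "\<phi> \<in> borel_measurable state_space"
  shows "lose \<phi> \<in> borel_measurable state_space"
proof -
  have [measurable]: "(\<lambda>x. \<phi> (fst x, snd x - 1)) \<in> borel_measurable state_space"
    using comp_shift_measurable[OF assms] .
  note assms[measurable]
  show ?thesis unfolding lose_def by measurable
qed

lemma jump_measurable [measurable (raw)]:
  assumes \<phi>: "\<phi> \<in> borel_measurable state_space"
    and f: "f \<in> N \<rightarrow>\<^sub>M state_space" and g: "g \<in> N \<rightarrow>\<^sub>M state_space"
  shows "(\<lambda>z. jump \<phi> (f z) (g z)) \<in> borel_measurable N"
  unfolding jump_eq
  by (intro borel_measurable_add measurable_compose[OF f lose_measurable[OF \<phi>]]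
      measurable_compose[OF g gain_measurable[OF \<phi>]])

lemma shift_in_space:
  "x \<in> space state_space \<Longrightarrow> (fst x, k) \<in> space state_space"
  by (auto simp: space_state_space)

lemma lose_bound:
  assumes "\<And>x. x \<in> space state_space \<Longrightarrow> \<bar>\<phi> x\<bar> \<le> b" "x \<in> space state_space"
  shows "\<bar>lose \<phi> x\<bar> \<le> 2 * b"
proof -
  have "\<bar>\<phi> x\<bar> \<le> b" "\<bar>\<phi> (fst x, snd x - 1)\<bar> \<le> b"
    using assms shift_in_space by blast+
  then show ?thesis unfolding lose_def by auto
qed

lemma gain_bound:
  assumes "\<And>x. x \<in> space state_space \<Longrightarrow> \<bar>\<phi> x\<bar> \<le> b" "x \<in> space state_space"
  shows "\<bar>gain \<phi> x\<bar> \<le> 2 * b"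
proof -
  have "\<bar>\<phi> x\<bar> \<le> b" "\<bar>\<phi> (fst x, snd x + 1)\<bar> \<le> b"
    using assms shift_in_space by blast+
  then show ?thesis unfolding gain_def by auto
qed

lemma integrable_pair_product:
  fixes g h :: "'a \<Rightarrow> real"
  assumes "sigma_finite_measure N" and g: "integrable N g" and h: "integrable N h"
  shows "integrable (N \<Otimes>\<^sub>M N) (\<lambda>z. g (fst z) * h (snd z))"
    and "(\<integral>z. g (fst z) * h (snd z) \<partial>(N \<Otimes>\<^sub>M N)) = (\<integral>x. g x \<partial>N) * (\<integral>x. h x \<partial>N)"
proof -
  interpret N: sigma_finite_measure N by fact
  interpret pair_sigma_finite N N ..
  have [measurable]: "g \<in> borel_measurable N" "h \<in> borel_measurable N" using g h by auto
  show 1: "integrable (N \<Otimes>\<^sub>M N) (\<lambda>z. g (fst z) * h (snd z))"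
    using g h by (intro Fubini_integrable) (auto simp: abs_mult)
  show "(\<integral>z. g (fst z) * h (snd z) \<partial>(N \<Otimes>\<^sub>M N)) = (\<integral>x. g x \<partial>N) * (\<integral>x. h x \<partial>N)"
    using integral_fst'[OF 1] by simp
qed

lemma integral_pair_bound:
  fixes g :: "'a \<Rightarrow> real" and F :: "'a \<times> 'a \<Rightarrow> real"
  assumes "sigma_finite_measure N" and g: "integrable N g"
    and F: "F \<in> borel_measurable (N \<Otimes>\<^sub>M N)"
    and le: "\<And>x y. x \<in> space N \<Longrightarrow> y \<in> space N \<Longrightarrow> \<bar>F (x, y)\<bar> \<le> c * (g x * g y)"
  shows "integrable (N \<Otimes>\<^sub>M N) F" and "\<bar>\<integral>z. F z \<partial>(N \<Otimes>\<^sub>M N)\<bar> \<le> c * (\<integral>x. g x \<partial>N)\<^sup>2"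
proof -
  note i = integrable_pair_product[OF assms(1,2,2)]
  have b: "AE z in N \<Otimes>\<^sub>M N. norm (F z) \<le> c * (g (fst z) * g (snd z))"
    by (intro AE_I2) (auto simp: space_pair_measure le)
  have ic: "integrable (N \<Otimes>\<^sub>M N) (\<lambda>z. c * (g (fst z) * g (snd z)))"
    using i(1) by simp
  show F': "integrable (N \<Otimes>\<^sub>M N) F"
    by (rule Bochner_Integration.integrable_bound[OF ic F]) (use b in auto)
  have "\<bar>\<integral>z. F z \<partial>(N \<Otimes>\<^sub>M N)\<bar> \<le> (\<integral>z. norm (F z) \<partial>(N \<Otimes>\<^sub>M N))"
    by (metis integral_norm_bound real_norm_def)
  also have "\<dots> \<le> (\<integral>z. c * (g (fst z) * g (snd z)) \<partial>(N \<Otimes>\<^sub>M N))"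
    by (rule integral_mono_AE) (use F' ic b in auto)
  finally show "\<bar>\<integral>z. F z \<partial>(N \<Otimes>\<^sub>M N)\<bar> \<le> c * (\<integral>x. g x \<partial>N)\<^sup>2"
    using i(2) by (simp add: power2_eq_square)
qed

text \<open>\<open>R\<close> stands for the product of W and c. The factor \<open>snd x\<close> in
  \<open>R_le\<close>, in place of \<open>wt x\<close>, records together with
  \<open>R_nonneg\<close> that a state at level 0 cannot lose.\<close>

locale jump_rates =
  fixes R :: "real \<times> nat \<Rightarrow> real \<times> nat \<Rightarrow> real" and \<Lambda> :: real
  assumes R_measurable [measurable]: "case_prod R \<in> borel_measurable (state_space \<Otimes>\<^sub>M state_space)"
    and R_nonneg: "x \<in> space state_space \<Longrightarrow> y \<in> space state_space \<Longrightarrow> 0 \<le> R x y"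
    and R_le: "x \<in> space state_space \<Longrightarrow> y \<in> space state_space \<Longrightarrow>
      R x y \<le> \<Lambda> * real (snd x) * wt y"
    and \<Lambda>_nonneg: "0 \<le> \<Lambda>"
begin

lemma R_measurable2 [measurable (raw)]:
  "f \<in> N \<rightarrow>\<^sub>M state_space \<Longrightarrow> g \<in> N \<rightarrow>\<^sub>M state_space \<Longrightarrow> (\<lambda>z. R (f z) (g z)) \<in> borel_measurable N"
  using measurable_compose[OF measurable_Pair R_measurable, of f N g] by simp

lemma R_abs_le:
  assumes "x \<in> space state_space" "y \<in> space state_space"
  shows "\<bar>R x y\<bar> \<le> \<Lambda> * (wt x * wt y)"
proof -
  have "\<Lambda> * real (snd x) * wt y \<le> \<Lambda> * wt x * wt y"
    using \<Lambda>_nonneg wt_ge_1[of y] by (intro mult_right_mono mult_left_mono) (auto simp: wt_def)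
  then show ?thesis using R_nonneg[OF assms] R_le[OF assms] by (simp add: mult.assoc)
qed

end

section \<open>Solutions and the class of functions for which the equation holds\<close>

locale jump_solution = jump_rates +
  fixes T M :: real and \<mu> :: "real \<Rightarrow> (real \<times> nat) measure"
  assumes T_nonneg: "0 \<le> T"
    and \<mu>_prob: "t \<in> {0..T} \<Longrightarrow> prob_space (\<mu> t)"
    and sets_\<mu>: "t \<in> {0..T} \<Longrightarrow> sets (\<mu> t) = sets state_space"
    and moment: "t \<in> {0..T} \<Longrightarrow> (\<integral>\<^sup>+ x. ennreal (real (snd x)) \<partial>\<mu> t) < ennreal M"
    and test_function_eq: "\<phi> \<in> test_functions \<Longrightarrow> t \<in> {0..T} \<Longrightarrow>
      set_integrable lborel {0..t}
        (\<lambda>s. \<integral>z. R (fst z) (snd z) * jump \<phi> (fst z) (snd z) \<partial>(\<mu> s \<Otimes>\<^sub>M \<mu> s)) \<and>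
      (\<integral>x. \<phi> x \<partial>\<mu> t) = (\<integral>x. \<phi> x \<partial>\<mu> 0) + (LINT s:{0..t}|lborel.
        (\<integral>z. R (fst z) (snd z) * jump \<phi> (fst z) (snd z) \<partial>(\<mu> s \<Otimes>\<^sub>M \<mu> s)))"
begin

definition rate :: "(real \<times> nat \<Rightarrow> real) \<Rightarrow> real \<Rightarrow> real" where
  "rate \<phi> s = (\<integral>z. R (fst z) (snd z) * jump \<phi> (fst z) (snd z) \<partial>(\<mu> s \<Otimes>\<^sub>M \<mu> s))"

text \<open>Integrability of the rate in time belongs to the predicate so that linear combinations
  and limits can be formed; measurability in time is inherited along these operations, starting from
  \<open>test_functions\<close>.\<close>

definition solves :: "(real \<times> nat \<Rightarrow> real) \<Rightarrow> bool" where
  "solves \<phi> \<longleftrightarrow> (\<forall>t \<in> {0..T}. set_integrable lborel {0..t} (rate \<phi>) \<and>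
     (\<integral>x. \<phi> x \<partial>\<mu> t) = (\<integral>x. \<phi> x \<partial>\<mu> 0) + (LINT s:{0..t}|lborel. rate \<phi> s))"

lemma solves_test_function: "\<phi> \<in> test_functions \<Longrightarrow> solves \<phi>"
  unfolding solves_def rate_def[abs_def] using test_function_eq by blast

lemma solvesD:
  assumes "solves \<phi>" "t \<in> {0..T}"
  shows "set_integrable lborel {0..t} (rate \<phi>)"
    and "(\<integral>x. \<phi> x \<partial>\<mu> t) = (\<integral>x. \<phi> x \<partial>\<mu> 0) + (LINT s:{0..t}|lborel. rate \<phi> s)"
  using assms unfolding solves_def by blast+

lemma space_\<mu>: "t \<in> {0..T} \<Longrightarrow> space (\<mu> t) = space state_space"
  using sets_\<mu> by (rule sets_eq_imp_space_eq)

lemma measurable_\<mu>: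
  "t \<in> {0..T} \<Longrightarrow> borel_measurable (\<mu> t) = borel_measurable state_space"
  "t \<in> {0..T} \<Longrightarrow> borel_measurable (\<mu> t \<Otimes>\<^sub>M \<mu> t) = borel_measurable (state_space \<Otimes>\<^sub>M state_space)"
  by (auto intro!: measurable_cong_sets sets_pair_measure_cong simp: sets_\<mu>)

lemma M_pos: "0 < M"
proof -
  have "0 < ennreal M" using moment[of 0] T_nonneg le_less_trans[OF zero_le] by fastforce
  then show ?thesis by simp
qed

lemma integrable_level:
  assumes "t \<in> {0..T}"
  shows "integrable (\<mu> t) (\<lambda>x. real (snd x))" "(\<integral>x. real (snd x) \<partial>\<mu> t) \<le> M"
proof -
  have [measurable]: "(\<lambda>x. real (snd x)) \<in> borel_measurable (\<mu> t)"
    unfolding measurable_\<mu>[OF assms] by measurable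
  show i: "integrable (\<mu> t) (\<lambda>x. real (snd x))"
    by (rule integrableI_nonneg)
      (use moment[OF assms] in \<open>auto intro: less_trans\<close>)
  have "ennreal (\<integral>x. real (snd x) \<partial>\<mu> t) = (\<integral>\<^sup>+ x. ennreal (real (snd x)) \<partial>\<mu> t)"
    by (rule nn_integral_eq_integral[symmetric, OF i]) auto
  also have "\<dots> \<le> ennreal M" using moment[OF assms] by simp
  finally show "(\<integral>x. real (snd x) \<partial>\<mu> t) \<le> M" using M_pos by simp
qed

lemma integrable_wt:
  assumes "t \<in> {0..T}"
  shows "integrable (\<mu> t) wt" "(\<integral>x. wt x \<partial>\<mu> t) \<le> 1 + M"
proof -
  interpret prob_space "\<mu> t" using assms by (rule \<mu>_prob)
  show "integrable (\<mu> t) wt" "(\<integral>x. wt x \<partial>\<mu> t) \<le> 1 + M"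
    unfolding wt_def[abs_def] using integrable_level[OF assms] by (simp_all add: prob_space)
qed

lemma integrable_le_wt:
  assumes "t \<in> {0..T}" "f \<in> borel_measurable state_space"
    and "\<And>x. x \<in> space state_space \<Longrightarrow> \<bar>f x\<bar> \<le> c * wt x"
  shows "integrable (\<mu> t) f"
proof (rule Bochner_Integration.integrable_bound)
  show "integrable (\<mu> t) (\<lambda>x. c * wt x)" using integrable_wt[OF assms(1)] by simp
  show "f \<in> borel_measurable (\<mu> t)" using assms by (simp add: measurable_\<mu>)
  show "AE x in \<mu> t. norm (f x) \<le> norm (c * wt x)"
    using assms(1,3) by (intro AE_I2) (auto simp: space_\<mu> intro: order_trans[OF _ abs_ge_self])
qed

lemma integrable_bounded:
  fixes f :: "real \<times> nat \<Rightarrow> real"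
  assumes "t \<in> {0..T}" "f \<in> borel_measurable state_space"
    and b: "\<And>x. x \<in> space state_space \<Longrightarrow> \<bar>f x\<bar> \<le> b"
  shows "integrable (\<mu> t) f"
proof (rule integrable_le_wt[OF assms(1,2)])
  fix x assume "x \<in> space state_space"
  from b[OF this] have "\<bar>f x\<bar> \<le> b" "0 \<le> b" by linarith+
  then show "\<bar>f x\<bar> \<le> b * wt x"
    using mult_left_mono[OF wt_ge_1, of b x] by simp
qed

lemma sigma_finite_\<mu>: "t \<in> {0..T} \<Longrightarrow> sigma_finite_measure (\<mu> t)"
  using \<mu>_prob prob_space_imp_sigma_finite by blast

text \<open>A jump involves four values of \<phi>, hence 4 * b; each of the two variables
  contributes one factor \<open>wt\<close>, whose mean is at most 1 + M.\<close>

lemma rate_bound: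
  assumes t: "t \<in> {0..T}" and \<phi>: "\<phi> \<in> borel_measurable state_space"
    and b: "\<And>x. x \<in> space state_space \<Longrightarrow> \<bar>\<phi> x\<bar> \<le> b"
  shows "integrable (\<mu> t \<Otimes>\<^sub>M \<mu> t) (\<lambda>z. R (fst z) (snd z) * jump \<phi> (fst z) (snd z))"
    and "\<bar>rate \<phi> t\<bar> \<le> 4 * b * \<Lambda> * (1 + M)\<^sup>2"
proof -
  note \<phi>[measurable]
  let ?F = "\<lambda>z. R (fst z) (snd z) * jump \<phi> (fst z) (snd z)"
  have m: "?F \<in> borel_measurable (\<mu> t \<Otimes>\<^sub>M \<mu> t)"
    unfolding measurable_\<mu>[OF t] by measurable
  have le: "\<bar>?F (x, y)\<bar> \<le> 4 * b * \<Lambda> * (wt x * wt y)"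
    if x: "x \<in> space (\<mu> t)" and y: "y \<in> space (\<mu> t)" for x y
  proof -
    have x': "x \<in> space state_space" and y': "y \<in> space state_space"
      using x y t by (simp_all add: space_\<mu>)
    have "0 \<le> b" using b[OF x'] by linarith
    have "\<bar>jump \<phi> x y\<bar> \<le> 4 * b"
      using lose_bound[of \<phi> b, OF b x'] gain_bound[of \<phi> b, OF b y'] unfolding jump_eq by linarith
    then have "\<bar>R x y\<bar> * \<bar>jump \<phi> x y\<bar> \<le> (\<Lambda> * (wt x * wt y)) * (4 * b)"
      by (intro mult_mono R_abs_le x' y')
        (use \<Lambda>_nonneg wt_ge_1[of x] wt_ge_1[of y] in \<open>auto\<close>)
    then show ?thesis by (simp add: abs_mult mult_ac)
  qed
  note bd = integral_pair_bound[OF sigma_finite_\<mu>[OF t] integrable_wt(1)[OF t] m le]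
  show "integrable (\<mu> t \<Otimes>\<^sub>M \<mu> t) ?F" by (rule bd(1))
  have "0 \<le> b"
    using b[of "(0, 0)"] by (simp add: space_state_space)
  have "0 \<le> (\<integral>x. wt x \<partial>\<mu> t)"
    by (rule integral_nonneg_AE) (auto intro!: AE_I2 order_trans[OF _ wt_ge_1])
  then have "4 * b * \<Lambda> * (\<integral>x. wt x \<partial>\<mu> t)\<^sup>2 \<le> 4 * b * \<Lambda> * (1 + M)\<^sup>2"
    using integrable_wt(2)[OF t] \<open>0 \<le> b\<close> \<Lambda>_nonneg by (intro mult_left_mono power_mono) auto
  with bd(2) show "\<bar>rate \<phi> t\<bar> \<le> 4 * b * \<Lambda> * (1 + M)\<^sup>2"
    unfolding rate_def by linarith
qed

text \<open>Dominated convergence at three places: over pairs of states with a multiple of wt x * wt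
  y as majorant, over time with the constant of \<open>rate_bound\<close>, and over states with the
  constant b.\<close>

lemma solves_limit:
  assumes s: "\<And>n. solves (f n)" and m: "\<And>n. f n \<in> borel_measurable state_space"
    and b: "\<And>n x. x \<in> space state_space \<Longrightarrow> \<bar>f n x\<bar> \<le> b"
    and lim: "\<And>x. x \<in> space state_space \<Longrightarrow> (\<lambda>n. f n x) \<longlonglongrightarrow> \<phi> x"
  shows "solves \<phi>"
proof -
  note m[measurable]
  have \<phi>[measurable]: "\<phi> \<in> borel_measurable state_space"
    by (rule borel_measurable_LIMSEQ_metric[OF m lim])
  have b\<phi>: "\<bar>\<phi> x\<bar> \<le> b" if "x \<in> space state_space" for x
    by (rule LIMSEQ_le_const2[OF tendsto_rabs[OF lim[OF that]]]) (use b that in auto)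
  have rate_lim: "(\<lambda>n. rate (f n) t) \<longlonglongrightarrow> rate \<phi> t" if t: "t \<in> {0..T}" for t
    unfolding rate_def
  proof (rule integral_dominated_convergence)
    show "(\<lambda>z. R (fst z) (snd z) * jump \<phi> (fst z) (snd z)) \<in> borel_measurable (\<mu> t \<Otimes>\<^sub>M \<mu> t)"
      "\<And>i. (\<lambda>z. R (fst z) (snd z) * jump (f i) (fst z) (snd z)) \<in> borel_measurable (\<mu> t \<Otimes>\<^sub>M \<mu> t)"
      unfolding measurable_\<mu>[OF t] by measurable
    show "integrable (\<mu> t \<Otimes>\<^sub>M \<mu> t) (\<lambda>z. 4 * b * \<Lambda> * (wt (fst z) * wt (snd z)))"
      using integrable_pair_product(1)[OF sigma_finite_\<mu>[OF t] integrable_wt(1)[OF t] integrable_wt(1)[OF t]] by simp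
    show "AE z in \<mu> t \<Otimes>\<^sub>M \<mu> t. (\<lambda>i. R (fst z) (snd z) * jump (f i) (fst z) (snd z))
            \<longlonglongrightarrow> R (fst z) (snd z) * jump \<phi> (fst z) (snd z)"
    proof (rule AE_I2)
      fix z assume "z \<in> space (\<mu> t \<Otimes>\<^sub>M \<mu> t)"
      then have z: "fst z \<in> space state_space" "snd z \<in> space state_space"
        using t by (auto simp: space_pair_measure space_\<mu>)
      have "(\<lambda>i. lose (f i) (fst z)) \<longlonglongrightarrow> lose \<phi> (fst z)"
        using z by (auto simp: lose_def intro!: tendsto_intros lim shift_in_space)
      moreover have "(\<lambda>i. gain (f i) (snd z)) \<longlonglongrightarrow> gain \<phi> (snd z)"
        using z unfolding gain_def by (intro tendsto_intros lim shift_in_space)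
      ultimately show "(\<lambda>i. R (fst z) (snd z) * jump (f i) (fst z) (snd z))
            \<longlonglongrightarrow> R (fst z) (snd z) * jump \<phi> (fst z) (snd z)"
        unfolding jump_eq by (intro tendsto_intros)
    qed
    show "\<And>i. AE z in \<mu> t \<Otimes>\<^sub>M \<mu> t. norm (R (fst z) (snd z) * jump (f i) (fst z) (snd z))
            \<le> 4 * b * \<Lambda> * (wt (fst z) * wt (snd z))"
    proof (rule AE_I2)
      fix i z assume "z \<in> space (\<mu> t \<Otimes>\<^sub>M \<mu> t)"
      then have z: "fst z \<in> space state_space" "snd z \<in> space state_space"
        using t by (auto simp: space_pair_measure space_\<mu>)
      have "0 \<le> b" using b[OF z(1)] abs_ge_zero order_trans by blast
      have "\<bar>jump (f i) (fst z) (snd z)\<bar> \<le> 4 * b"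
        using lose_bound[of "f i" b, OF b z(1)] gain_bound[of "f i" b, OF b z(2)]
        unfolding jump_eq by linarith
      then have "\<bar>R (fst z) (snd z)\<bar> * \<bar>jump (f i) (fst z) (snd z)\<bar>
          \<le> (\<Lambda> * (wt (fst z) * wt (snd z))) * (4 * b)"
        by (intro mult_mono R_abs_le z)
          (use \<Lambda>_nonneg wt_ge_1[of "fst z"] wt_ge_1[of "snd z"] in auto)
      then show "norm (R (fst z) (snd z) * jump (f i) (fst z) (snd z))
            \<le> 4 * b * \<Lambda> * (wt (fst z) * wt (snd z))"
        by (simp add: abs_mult mult_ac)
    qed
  qed
  show ?thesis unfolding solves_def
  proof (intro ballI conjI)
    fix t assume t: "t \<in> {0..T}"
    have meas: "(\<lambda>s. indicat_real {0..t} s *\<^sub>R rate (f n) s) \<in> borel_measurable lborel" for n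
      by (rule borel_measurable_integrable[OF solvesD(1)[OF s t, unfolded set_integrable_def]])
    have lim': "(\<lambda>n. indicat_real {0..t} s *\<^sub>R rate (f n) s)
        \<longlonglongrightarrow> indicat_real {0..t} s *\<^sub>R rate \<phi> s" for s
      using rate_lim[of s] t by (cases "s \<in> {0..t}") auto
    have meas': "(\<lambda>s. indicat_real {0..t} s *\<^sub>R rate \<phi> s) \<in> borel_measurable lborel"
      by (rule borel_measurable_LIMSEQ_metric[OF meas lim'])
    have dom: "integrable lborel (\<lambda>s. indicat_real {0..t} s *\<^sub>R (4 * b * \<Lambda> * (1 + M)\<^sup>2))"
      by (rule integrable_scaleR_left) (rule integrable_real_indicator, simp_all add: emeasure_lborel_Icc_eq)
    have le: "norm (indicat_real {0..t} s *\<^sub>R rate (f n) s)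
        \<le> indicat_real {0..t} s *\<^sub>R (4 * b * \<Lambda> * (1 + M)\<^sup>2)" for s n
      using rate_bound(2)[OF _ m b, of s n] t by (cases "s \<in> {0..t}") auto
    note dct = meas' meas dom AE_I2[OF lim'] AE_I2[OF le]
    show "set_integrable lborel {0..t} (rate \<phi>)"
      unfolding set_integrable_def by (rule integrable_dominated_convergence[OF dct])
    have L: "(\<lambda>n. LINT s:{0..t}|lborel. rate (f n) s) \<longlonglongrightarrow> (LINT s:{0..t}|lborel. rate \<phi> s)"
      unfolding set_lebesgue_integral_def by (rule integral_dominated_convergence[OF dct])
    have I: "(\<lambda>n. \<integral>x. f n x \<partial>\<mu> t) \<longlonglongrightarrow> (\<integral>x. \<phi> x \<partial>\<mu> t)" if t: "t \<in> {0..T}" for t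
    proof (rule integral_dominated_convergence[where w = "\<lambda>_. b"])
      interpret prob_space "\<mu> t" using t by (rule \<mu>_prob)
      show "integrable (\<mu> t) (\<lambda>_. b)" by simp
    qed (use t m \<phi> b lim in \<open>auto simp: measurable_\<mu> space_\<mu>\<close>)
    have "(\<lambda>n. \<integral>x. f n x \<partial>\<mu> t) \<longlonglongrightarrow> (\<integral>x. \<phi> x \<partial>\<mu> 0) + (LINT s:{0..t}|lborel. rate \<phi> s)"
      unfolding solvesD(2)[OF s t] using T_nonneg by (intro tendsto_add[OF I L]) simp
    then show "(\<integral>x. \<phi> x \<partial>\<mu> t) = (\<integral>x. \<phi> x \<partial>\<mu> 0) + (LINT s:{0..t}|lborel. rate \<phi> s)"
      using I[OF t] by (rule LIMSEQ_unique[rotated])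
  qed
qed

text \<open>Functions are compared on the carrier only; a constant sequence makes this a case of
  \<open>solves_limit\<close>.\<close>

lemma solves_cong:
  assumes "solves f" "f \<in> borel_measurable state_space"
    and "\<And>x. x \<in> space state_space \<Longrightarrow> \<bar>f x\<bar> \<le> b"
    and eq: "\<And>x. x \<in> space state_space \<Longrightarrow> f x = g x"
  shows "solves g"
proof (rule solves_limit[of "\<lambda>_. f" b, OF assms(1-3)])
  fix x assume "x \<in> space state_space"
  then show "(\<lambda>_. f x) \<longlonglongrightarrow> g x" by (simp add: eq)
qed

lemma solves_linear:
  assumes s: "solves f" "solves g"
    and m [measurable]: "f \<in> borel_measurable state_space" "g \<in> borel_measurable state_space"
    and b: "\<And>x. x \<in> space state_space \<Longrightarrow> \<bar>f x\<bar> \<le> b" "\<And>x. x \<in> space state_space \<Longrightarrow> \<bar>g x\<bar> \<le> b'"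
  shows "solves (\<lambda>x. a * f x + g x)"
proof -
  have rate_eq: "rate (\<lambda>x. a * f x + g x) t = a * rate f t + rate g t" if t: "t \<in> {0..T}" for t
  proof -
    have "jump (\<lambda>x. a * f x + g x) x y = a * jump f x y + jump g x y" for x y
      by (auto simp: jump_def algebra_simps split: prod.splits)
    then have "rate (\<lambda>x. a * f x + g x) t = (\<integral>z. a * (R (fst z) (snd z) * jump f (fst z) (snd z)) +
        R (fst z) (snd z) * jump g (fst z) (snd z) \<partial>(\<mu> t \<Otimes>\<^sub>M \<mu> t))"
      unfolding rate_def by (simp add: algebra_simps)
    also have "\<dots> = a * rate f t + rate g t"
      unfolding rate_def using rate_bound(1)[OF t m(1) b(1)] rate_bound(1)[OF t m(2) b(2)] by simp
    finally show ?thesis .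
  qed
  show ?thesis unfolding solves_def
  proof (intro ballI)
    fix t assume t: "t \<in> {0..T}"
    have rate_eq': "s \<in> {0..t} \<Longrightarrow> rate (\<lambda>x. a * f x + g x) s = a * rate f s + rate g s" for s
      using t by (intro rate_eq) auto
    have ii: "set_integrable lborel {0..t} (rate f)" "set_integrable lborel {0..t} (rate g)"
      using s t by (auto intro: solvesD)
    have A: "set_integrable lborel {0..t} (rate (\<lambda>x. a * f x + g x)) \<longleftrightarrow>
        set_integrable lborel {0..t} (\<lambda>s. a * rate f s + rate g s)"
      by (rule set_integrable_cong[OF refl refl rate_eq'])
    have B: "(LINT s:{0..t}|lborel. rate (\<lambda>x. a * f x + g x) s) =
        (LINT s:{0..t}|lborel. a * rate f s + rate g s)"
      by (rule set_lebesgue_integral_cong) (use rate_eq' in auto)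
    have I: "(\<integral>x. a * f x + g x \<partial>\<mu> t) = a * (\<integral>x. f x \<partial>\<mu> t) + (\<integral>x. g x \<partial>\<mu> t)"
      if "t \<in> {0..T}" for t
      using integrable_bounded[OF that m(1) b(1)] integrable_bounded[OF that m(2) b(2)] by simp
    show "set_integrable lborel {0..t} (rate (\<lambda>x. a * f x + g x)) \<and>
      (\<integral>x. a * f x + g x \<partial>\<mu> t) = (\<integral>x. a * f x + g x \<partial>\<mu> 0) +
         (LINT s:{0..t}|lborel. rate (\<lambda>x. a * f x + g x) s)"
      unfolding A B I[OF t] solvesD(2)[OF s(1) t] solvesD(2)[OF s(2) t]
      using ii T_nonneg I[of 0] by (simp add: set_integral_add algebra_simps)
  qed
qed

end

section \<open>Bounded measurable test functions\<close>

lemma rectangle_in_state_space: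
  "A \<in> sets unit_borel \<Longrightarrow> A \<times> B \<in> sets state_space"
  unfolding state_space_def by (rule pair_measureI) auto

lemma sets_unit_borel: "sets unit_borel = (\<inter>) {0..1} ` sets borel"
  by (simp add: unit_borel_def sets_restrict_space)

lemma indicator_rectangle_measurable:
  fixes A :: "real set" and B :: "nat set"
  assumes "A \<in> sets borel"
  shows "(indicator (A \<times> B) :: real \<times> nat \<Rightarrow> real) \<in> borel_measurable state_space"
proof -
  have "({0..1} \<inter> A) \<times> B \<in> sets state_space"
    using assms by (intro rectangle_in_state_space) (simp add: sets_unit_borel)
  moreover have "({0..1} \<inter> A) \<times> B = A \<times> B \<inter> space state_space"
    by (auto simp: space_state_space)
  ultimately show ?thesis by (simp add: borel_measurable_indicator_iff)
qed

context jump_solution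
begin

text \<open>The indicator of a closed set is the bounded limit of the continuous functions max 0 (1
  - n * infdist u A); fixing the level k preserves continuity because the second factor is
  discrete.\<close>

lemma solves_closed_rectangle:
  assumes "closed A"
  shows "solves (indicator (A \<times> {k}))"
\<comment> \<open>\<open>infdist\<close> to the empty set is 0 by definition, so the approximation
  used below would have the wrong limit.\<close>
proof (cases "A = {}")
  case True
  have "(\<lambda>_. 0) \<in> test_functions" by (auto simp: test_functions_def intro!: boundedI[where B = 0])
  moreover have "indicator (A \<times> {k}) = (\<lambda>_. 0 :: real)" using True by auto
  ultimately show ?thesis by (simp add: solves_test_function)
next
  case False
  define f where "f n x = max 0 (1 - real n * infdist (fst x) A) * (if snd x = k then 1 else 0)"
    for n and x :: "real \<times> nat"
  have c: "continuous_on UNIV (f n)" for n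
  proof -
    have "continuous_on UNIV (\<lambda>x :: real \<times> nat. (\<lambda>j. if j = k then 1 else 0 :: real) (snd x))"
      by (rule continuous_on_compose2[OF Topological_Spaces.continuous_on_discrete[of UNIV]])
        (auto intro: continuous_on_snd continuous_on_id)
    then show ?thesis
      unfolding f_def by (intro continuous_intros) auto
  qed
  have b: "\<bar>f n x\<bar> \<le> 1" for n x
    by (auto simp: f_def infdist_nonneg)
  show ?thesis
  proof (rule solves_limit)
    have "f n \<in> test_functions" for n
      unfolding test_functions_def using continuous_on_subset[OF c] b
      by (auto intro!: boundedI[where B = 1])
    then show "solves (f n)" for n by (rule solves_test_function)
    show "f n \<in> borel_measurable state_space" for n
    proof -
      have [measurable]: "fst \<in> state_space \<rightarrow>\<^sub>M borel"
        using fst_measurable unfolding unit_borel_def by (simp add: measurable_restrict_space2_iff)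
      have [measurable]: "(\<lambda>u. infdist u A) \<in> borel_measurable borel"
        by (intro borel_measurable_continuous_onI continuous_intros)
      show ?thesis unfolding f_def[abs_def] by measurable
    qed
    show "\<bar>f n x\<bar> \<le> 1" for n x by (rule b)
    show "(\<lambda>n. f n x) \<longlonglongrightarrow> indicator (A \<times> {k}) x" for x
    proof (cases "fst x \<in> A")
      case True
      then show ?thesis by (auto simp: f_def indicator_def mem_Times_iff)
    next
      case notin: False
      then have pos: "0 < infdist (fst x) A"
        using in_closed_iff_infdist_zero[OF assms \<open>A \<noteq> {}\<close>] infdist_nonneg[of "fst x" A]
        by (auto simp: less_le)
      have "\<forall>\<^sub>F n in sequentially. f n x = 0"
      proof (rule eventually_sequentiallyI)
        fix n assume "nat \<lceil>1 / infdist (fst x) A\<rceil> \<le> n"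
        then have "1 / infdist (fst x) A \<le> real n" by linarith
        then have "1 \<le> real n * infdist (fst x) A" using pos by (simp add: field_simps)
        then show "f n x = 0" by (simp add: f_def)
      qed
      then show ?thesis using notin
        by (auto simp: indicator_def mem_Times_iff intro: tendsto_eventually)
    qed
  qed
qed

lemma solves_sum:
  fixes f :: "'i \<Rightarrow> real \<times> nat \<Rightarrow> real"
  assumes "finite I"
    and "\<And>i. i \<in> I \<Longrightarrow> solves (f i)" "\<And>i. i \<in> I \<Longrightarrow> f i \<in> borel_measurable state_space"
    and "\<And>i x. i \<in> I \<Longrightarrow> x \<in> space state_space \<Longrightarrow> \<bar>f i x\<bar> \<le> b"
  shows "solves (\<lambda>x. \<Sum>i\<in>I. a i * f i x)"
  using assms
proof (induction I rule: finite_induct)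
  case empty
  have "(\<lambda>_. 0) \<in> test_functions" by (auto simp: test_functions_def intro!: boundedI[where B = 0])
  then show ?case by (simp add: solves_test_function)
next
  case (insert i I)
  have "solves (\<lambda>x. a i * f i x + (\<Sum>i\<in>I. a i * f i x))"
  proof (rule solves_linear)
    show "solves (f i)" "solves (\<lambda>x. \<Sum>i\<in>I. a i * f i x)" "f i \<in> borel_measurable state_space"
      using insert by auto
    show "(\<lambda>x. \<Sum>i\<in>I. a i * f i x) \<in> borel_measurable state_space"
      using insert by (intro borel_measurable_sum borel_measurable_times) auto
    show "\<bar>f i x\<bar> \<le> b" if "x \<in> space state_space" for x using insert that by auto
    show "\<bar>\<Sum>i\<in>I. a i * f i x\<bar> \<le> (\<Sum>i\<in>I. \<bar>a i\<bar> * b)" if "x \<in> space state_space" for x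
      using insert.prems(3) that
      by (intro order_trans[OF sum_abs] sum_mono)
        (metis abs_ge_zero abs_mult insertCI mult_left_mono)
  qed
  then show ?case using insert by simp
qed

lemma solves_disjoint_union:
  fixes A :: "nat \<Rightarrow> (real \<times> nat) set"
  assumes disj: "disjoint_family A"
    and m: "\<And>i. (indicator (A i) :: _ \<Rightarrow> real) \<in> borel_measurable state_space"
    and s: "\<And>i. solves (indicator (A i))"
  shows "solves (indicator (\<Union>i. A i))"
proof (rule solves_limit)
  have eq: "(\<Sum>i<n. indicator (A i) x) = (indicator (\<Union>i<n. A i) x :: real)" for n x
    using disj by (intro indicator_UN_disjoint[symmetric]) (auto intro: disjoint_family_on_mono)
  show "solves (\<lambda>x. \<Sum>i<n. indicator (A i) x)" for n
    using solves_sum[of "{..<n}" "\<lambda>i. indicator (A i)" 1 "\<lambda>_. 1"] s m by (simp add: indicator_def)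
  show "(\<lambda>x. \<Sum>i<n. indicator (A i) x :: real) \<in> borel_measurable state_space" for n
    using m by (intro borel_measurable_sum)
  show "\<bar>\<Sum>i<n. indicator (A i) x :: real\<bar> \<le> 1" for n x
    unfolding eq by (simp add: indicator_def)
  show "(\<lambda>n. \<Sum>i<n. indicator (A i) x) \<longlonglongrightarrow> (indicator (\<Union>i. A i) x :: real)" for x
    unfolding eq by (rule LIMSEQ_indicator_UN)
qed

text \<open>Closed sets are stable under intersection and generate the Borel sets, so Dynkin's
  theorem applies: complements come from \<open>solves_linear\<close> and the closed set
  \<open>UNIV\<close>, disjoint unions from \<open>solves_disjoint_union\<close>.\<close>

lemma solves_rectangle:
  assumes "A \<in> sets borel"
  shows "solves (indicator (A \<times> {k}))"
proof -
  have "Int_stable (Collect closed :: real set set)" by (auto simp: Int_stable_def)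
  moreover have "Collect closed \<subseteq> Pow (UNIV :: real set)" by simp
  moreover have "A \<in> sigma_sets UNIV (Collect closed)"
    using assms by (simp add: borel_eq_closed)
  ultimately show ?thesis
  proof (induction A rule: sigma_sets_induct_disjoint)
    case (basic A)
    then show ?case by (simp add: solves_closed_rectangle)
  next
    case empty
    show ?case by (rule solves_closed_rectangle) simp
  next
    case (compl A)
    then have A: "A \<in> sets borel" by (simp add: borel_eq_closed)
    have "solves (\<lambda>x. (-1) * indicator (A \<times> {k}) x + indicator (UNIV \<times> {k}) x)"
      by (rule solves_linear[where b = 1 and b' = 1])
        (use compl A in \<open>auto intro!: solves_closed_rectangle indicator_rectangle_measurable\<close>)
    moreover have "(\<lambda>x. (-1) * indicator (A \<times> {k}) x + indicator (UNIV \<times> {k}) x) =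
      (indicator ((UNIV - A) \<times> {k}) :: real \<times> nat \<Rightarrow> real)"
      by (auto simp: indicator_def)
    ultimately show ?case by simp
  next
    case (union A)
    have "solves (indicator (\<Union>i. A i \<times> {k}))"
    proof (rule solves_disjoint_union)
      show "disjoint_family (\<lambda>i. A i \<times> {k})"
        unfolding disjoint_family_on_def
      proof (intro ballI impI)
        fix i j :: nat assume "i \<noteq> j"
        then have "A i \<inter> A j = {}" using union(1) by (simp add: disjoint_family_on_def)
        then show "A i \<times> {k} \<inter> A j \<times> {k} = {}" by blast
      qed
      show "(indicator (A i \<times> {k}) :: _ \<Rightarrow> real) \<in> borel_measurable state_space" for i
        using union(2) by (intro indicator_rectangle_measurable) (auto simp: borel_eq_closed)
    qed (rule union)
    moreover have "(\<Union>i. A i \<times> {k}) = (\<Union>i. A i) \<times> {k}" by auto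
    ultimately show ?case by simp
  qed
qed

text \<open>A measurable set of states is the countable disjoint union of its level slices, each a
  Borel set of positions times a single level.\<close>

lemma solves_indicator:
  assumes E: "E \<in> sets state_space"
  shows "solves (indicator E)"
proof -
  define S where "S k = {u \<in> {0..1}. (u, k) \<in> E}" for k
  have S: "S k \<in> sets borel" for k
  proof -
    have m: "(\<lambda>u. (u, k)) \<in> unit_borel \<rightarrow>\<^sub>M state_space"
      unfolding state_space_def by measurable
    have "S k = (\<lambda>u. (u, k)) -` E \<inter> space unit_borel"
      by (auto simp: S_def unit_borel_def)
    then have "S k \<in> sets unit_borel" using measurable_sets[OF m E] by simp
    then show ?thesis by (auto simp: sets_unit_borel)
  qed
  have "solves (indicator (\<Union>k. S k \<times> {k}))"
    by (rule solves_disjoint_union)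
      (auto simp: disjoint_family_on_def intro!: indicator_rectangle_measurable solves_rectangle S)
  moreover have "(\<Union>k. S k \<times> {k}) = E"
    using sets.sets_into_space[OF E] by (auto simp: S_def space_state_space)
  ultimately show ?thesis by simp
qed

text \<open>Simple functions approximate \<phi> pointwise; the bound 2 * b comes from the
  approximation theorem, which controls the distance to 0 only up to a factor 2.\<close>

lemma solves_bounded_measurable:
  assumes m: "\<phi> \<in> borel_measurable state_space"
    and b: "\<And>x. x \<in> space state_space \<Longrightarrow> \<bar>\<phi> x\<bar> \<le> b"
  shows "solves \<phi>"
proof -
  obtain f where f: "\<And>i. simple_function state_space (f i)"
    and lim: "\<And>x. x \<in> space state_space \<Longrightarrow> (\<lambda>i. f i x) \<longlonglongrightarrow> \<phi> x"
    and bf: "\<And>i x. x \<in> space state_space \<Longrightarrow> dist (f i x) 0 \<le> 2 * dist (\<phi> x) 0"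
    using borel_measurable_implies_sequence_metric[OF m, of 0] by blast
  have fb: "\<bar>f i x\<bar> \<le> 2 * b" if "x \<in> space state_space" for i x
    using bf[OF that, of i] b[OF that] by simp
  show ?thesis
  proof (rule solves_limit[OF _ borel_measurable_simple_function[OF f] fb lim])
    fix i
    let ?V = "f i ` space state_space" and ?I = "\<lambda>y. f i -` {y} \<inter> space state_space"
    have I: "?I y \<in> sets state_space" for y by (rule simple_functionD(2)[OF f])
    have "solves (\<lambda>x. \<Sum>y\<in>?V. y * indicator (?I y) x)"
    proof (rule solves_sum)
      show "finite ?V" by (rule simple_functionD(1)[OF f])
      show "solves (indicator (?I y))" for y by (rule solves_indicator[OF I])
      show "(indicator (?I y) :: _ \<Rightarrow> real) \<in> borel_measurable state_space" for y
        by (rule borel_measurable_indicator[OF I])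
      show "\<bar>indicator (?I y) x :: real\<bar> \<le> 1" for x y by (simp add: indicator_def)
    qed
    then show "solves (f i)"
    proof (rule solves_cong)
      show "(\<Sum>y\<in>?V. y * indicator (?I y) x) = f i x" if "x \<in> space state_space" for x
      proof -
        have "f i x = (\<Sum>y\<in>?V. indicator (?I y) x *\<^sub>R y)"
          by (rule simple_function_indicator_representation_banach[OF f that])
        also have "\<dots> = (\<Sum>y\<in>?V. y * indicator (?I y) x)"
          by (intro sum.cong refl) (simp add: mult.commute)
        finally show ?thesis by (rule sym)
      qed
      then show "\<bar>\<Sum>y\<in>?V. y * indicator (?I y) x\<bar> \<le> 2 * b" if "x \<in> space state_space" for x
        using fb[OF that, of i] that by presburger
      show "(\<lambda>x. \<Sum>y\<in>?V. y * indicator (?I y) x) \<in> borel_measurable state_space"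
        by (intro borel_measurable_sum borel_measurable_times borel_measurable_const
            borel_measurable_indicator I)
    qed
  qed
qed

lemma increment_eq:
  assumes m: "\<phi> \<in> borel_measurable state_space"
    and b: "\<And>x. x \<in> space state_space \<Longrightarrow> \<bar>\<phi> x\<bar> \<le> b"
    and t: "0 \<le> t" "t \<le> t'" "t' \<le> T"
  shows "set_integrable lborel {t..t'} (rate \<phi>)"
    and "(\<integral>x. \<phi> x \<partial>\<mu> t') - (\<integral>x. \<phi> x \<partial>\<mu> t) = (LINT s:{t..t'}|lborel. rate \<phi> s)"
proof -
  note s = solves_bounded_measurable[OF m b]
  have tt: "t \<in> {0..T}" "t' \<in> {0..T}" using t by auto
  have i: "set_integrable lborel {0..t'} (rate \<phi>)" by (rule solvesD(1)[OF s tt(2)])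
  show j: "set_integrable lborel {t..t'} (rate \<phi>)"
    by (rule set_integrable_subset[OF i]) (use t in auto)
  \<comment> \<open>The two intervals overlap in the single point t, a null set.\<close>
  have "AE x in lborel. \<not> (x \<in> {0..t} \<and> x \<in> {t..t'})"
    using AE_lborel_singleton[of t] by eventually_elim auto
  then have "(LINT s:{0..t} \<union> {t..t'}|lborel. rate \<phi> s) =
      (LINT s:{0..t}|lborel. rate \<phi> s) + (LINT s:{t..t'}|lborel. rate \<phi> s)"
    using solvesD(1)[OF s tt(1)] j by (intro set_integral_Un_AE) auto
  moreover have "{0..t} \<union> {t..t'} = {0..t'}" using t by auto
  ultimately show "(\<integral>x. \<phi> x \<partial>\<mu> t') - (\<integral>x. \<phi> x \<partial>\<mu> t) = (LINT s:{t..t'}|lborel. rate \<phi> s)"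
    using solvesD(2)[OF s tt(1)] solvesD(2)[OF s tt(2)] by simp
qed

end

section \<open>Second moments and Lipschitz continuity in time\<close>

context jump_solution
begin

lemma increment_le:
  assumes m: "\<phi> \<in> borel_measurable state_space"
    and b: "\<And>x. x \<in> space state_space \<Longrightarrow> \<bar>\<phi> x\<bar> \<le> b"
    and t: "0 \<le> t" "t \<le> t'" "t' \<le> T"
    and c: "\<And>s. s \<in> {t..t'} \<Longrightarrow> rate \<phi> s \<le> c"
  shows "(\<integral>x. \<phi> x \<partial>\<mu> t') \<le> (\<integral>x. \<phi> x \<partial>\<mu> t) + (t' - t) * c"
proof -
  have "(LINT s:{t..t'}|lborel. rate \<phi> s) \<le> (LINT s:{t..t'}|lborel. c)"
    by (rule set_integral_mono[OF increment_eq(1)[OF m b t]])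
      (use c t in \<open>auto simp: set_integrable_def emeasure_lborel_Icc_eq\<close>)
  then show ?thesis
    using increment_eq(2)[OF m b t] t by (simp add: set_lebesgue_integral_def)
qed

lemma increment_abs_le:
  assumes m: "\<phi> \<in> borel_measurable state_space"
    and b: "\<And>x. x \<in> space state_space \<Longrightarrow> \<bar>\<phi> x\<bar> \<le> b"
    and t: "t \<in> {0..T}" "t' \<in> {0..T}"
    and c: "\<And>s. s \<in> {0..T} \<Longrightarrow> \<bar>rate \<phi> s\<bar> \<le> c"
  shows "\<bar>(\<integral>x. \<phi> x \<partial>\<mu> t') - (\<integral>x. \<phi> x \<partial>\<mu> t)\<bar> \<le> c * \<bar>t' - t\<bar>"
  using t
proof (induction t t' rule: linorder_wlog)
  case (le t t')
  have m': "(\<lambda>x. - \<phi> x) \<in> borel_measurable state_space" using m by simp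
  have b': "\<bar>- \<phi> x\<bar> \<le> b" if "x \<in> space state_space" for x using b[OF that] by simp
  have "rate (\<lambda>x. - \<phi> x) s = - rate \<phi> s" for s
  proof -
    have "jump (\<lambda>x. - \<phi> x) x y = - jump \<phi> x y" for x y
      by (auto simp: jump_def split: prod.splits)
    then show ?thesis unfolding rate_def by simp
  qed
  then have "(\<integral>x. - \<phi> x \<partial>\<mu> t') \<le> (\<integral>x. - \<phi> x \<partial>\<mu> t) + (t' - t) * c"
    using le c by (intro increment_le[OF m' b']) (auto simp: abs_le_iff)
  moreover have "(\<integral>x. \<phi> x \<partial>\<mu> t') \<le> (\<integral>x. \<phi> x \<partial>\<mu> t) + (t' - t) * c"
    using le c by (intro increment_le[OF m b]) (auto simp: abs_le_iff)
  ultimately show ?case using le by (simp add: abs_le_iff mult.commute)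
next
  case (sym t t')
  then show ?case by (simp add: abs_minus_commute)
qed

end

text \<open>The equation is available for bounded functions only. Capping the level keeps
  monotonicity in k, on which the sign of the loss rests.\<close>

definition capped_sq :: "nat \<Rightarrow> real \<times> nat \<Rightarrow> real" where
  "capped_sq N x = (real (min (snd x) N))\<^sup>2"

lemma capped_sq_measurable [measurable]: "capped_sq N \<in> borel_measurable state_space"
  unfolding capped_sq_def by measurable

lemma capped_sq_bound: "\<bar>capped_sq N x\<bar> \<le> (real N)\<^sup>2"
  unfolding capped_sq_def by (auto intro!: power_mono)

lemma capped_sq_nonneg: "0 \<le> capped_sq N x"
  by (simp add: capped_sq_def)

lemma lose_capped_sq: "lose (capped_sq N) x \<le> 0"
  by (auto simp: lose_def capped_sq_def intro!: power_mono)

text \<open>Below the cap, with l = snd x, the left side is (1 + l) * (2 * l + 1) = 1 + 3 * l + 2 *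
  l^2, and l \<le> l^2 for natural numbers gives the constant 5; from the cap on, the gain is
  0.\<close>

lemma gain_capped_sq: "wt x * gain (capped_sq N) x \<le> 1 + 5 * capped_sq N x"
proof (cases "snd x < N")
  case True
  define l where "l = real (snd x)"
  have "l \<le> l\<^sup>2" by (simp add: l_def power2_eq_square flip: of_nat_mult)
  then show ?thesis using True
    by (simp add: wt_def gain_def capped_sq_def min_def power2_eq_square algebra_simps flip: l_def)
next
  case False
  then show ?thesis by (simp add: gain_def capped_sq_def min_def)
qed

locale second_moment_solution = jump_solution +
  assumes second_moment: "(\<integral>\<^sup>+ x. ennreal ((real (snd x))\<^sup>2) \<partial>\<mu> 0) < \<infinity>"
begin

text \<open>Losses are dropped by sign. For a gain at y the rate and the increment are each linear
  in the level of y, and the rate is linear in that of x: a first moment times a second moment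
  arises, never a third. The a priori first moment makes the estimate linear.\<close>

lemma rate_capped_sq_le:
  assumes s: "s \<in> {0..T}"
  shows "rate (capped_sq N) s \<le> \<Lambda> * M * (1 + 5 * (\<integral>x. capped_sq N x \<partial>\<mu> s))"
proof -
  interpret P: prob_space "\<mu> s" using s by (rule \<mu>_prob)
  have icapped: "integrable (\<mu> s) (capped_sq N)"
    by (rule integrable_bounded[OF s capped_sq_measurable capped_sq_bound])
  then have ig: "integrable (\<mu> s) (\<lambda>x. 1 + 5 * capped_sq N x)" by simp
  note il = integrable_level[OF s]
  note pp = integrable_pair_product[OF sigma_finite_\<mu>[OF s] il(1) ig]
  have "rate (capped_sq N) s \<le> (\<integral>z. \<Lambda> * (real (snd (fst z)) * (1 + 5 * capped_sq N (snd z))) \<partial>(\<mu> s \<Otimes>\<^sub>M \<mu> s))"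
    unfolding rate_def
  proof (rule integral_mono)
    show "integrable (\<mu> s \<Otimes>\<^sub>M \<mu> s) (\<lambda>z. R (fst z) (snd z) * jump (capped_sq N) (fst z) (snd z))"
      by (rule rate_bound(1)[OF s capped_sq_measurable capped_sq_bound])
    show "integrable (\<mu> s \<Otimes>\<^sub>M \<mu> s) (\<lambda>z. \<Lambda> * (real (snd (fst z)) * (1 + 5 * capped_sq N (snd z))))"
      using pp(1) by simp
    fix z assume "z \<in> space (\<mu> s \<Otimes>\<^sub>M \<mu> s)"
    then have z: "fst z \<in> space state_space" "snd z \<in> space state_space"
      using s by (auto simp: space_pair_measure space_\<mu>)
    have g0: "0 \<le> gain (capped_sq N) (snd z)"
      by (auto simp: gain_def capped_sq_def intro!: power_mono)
    have "R (fst z) (snd z) * jump (capped_sq N) (fst z) (snd z) \<le> R (fst z) (snd z) * gain (capped_sq N) (snd z)"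
      using lose_capped_sq[of N "fst z"] R_nonneg[OF z] by (intro mult_left_mono) (auto simp: jump_eq)
    also have "\<dots> \<le> \<Lambda> * real (snd (fst z)) * wt (snd z) * gain (capped_sq N) (snd z)"
      using R_le[OF z] g0 by (rule mult_right_mono)
    also have "\<dots> = \<Lambda> * real (snd (fst z)) * (wt (snd z) * gain (capped_sq N) (snd z))" by simp
    also have "\<dots> \<le> \<Lambda> * real (snd (fst z)) * (1 + 5 * capped_sq N (snd z))"
      using gain_capped_sq \<Lambda>_nonneg by (intro mult_left_mono) auto
    finally show "R (fst z) (snd z) * jump (capped_sq N) (fst z) (snd z)
      \<le> \<Lambda> * (real (snd (fst z)) * (1 + 5 * capped_sq N (snd z)))" by simp
  qed
  also have "\<dots> = \<Lambda> * ((\<integral>x. real (snd x) \<partial>\<mu> s) * (1 + 5 * (\<integral>x. capped_sq N x \<partial>\<mu> s)))"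
    using pp(2) icapped by (simp add: P.prob_space)
  also have "\<dots> \<le> \<Lambda> * (M * (1 + 5 * (\<integral>x. capped_sq N x \<partial>\<mu> s)))"
  proof -
    have "0 \<le> (\<integral>x. capped_sq N x \<partial>\<mu> s)" by (rule integral_nonneg_AE) (simp add: capped_sq_def)
    then show ?thesis using il(2) \<Lambda>_nonneg by (intro mult_left_mono mult_right_mono) auto
  qed
  finally show ?thesis by simp
qed

text \<open>The exponent is free of N: the N-dependent Lipschitz constant enters only the terms of
  order h^2, which disappear in \<open>gronwall_increments\<close>. The approximating family is
  constant here.\<close>

lemma integral_capped_sq_le:
  assumes t: "t \<in> {0..T}"
  shows "1 + 5 * (\<integral>x. capped_sq N x \<partial>\<mu> t) \<le> (1 + 5 * (\<integral>x. capped_sq N x \<partial>\<mu> 0)) * exp (5 * \<Lambda> * M * t)"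
proof -
  define f where "f t = 1 + 5 * (\<integral>x. capped_sq N x \<partial>\<mu> t)" for t
  define L where "L = 4 * (real N)\<^sup>2 * \<Lambda> * (1 + M)\<^sup>2"
  have lip: "\<bar>f s - f t\<bar> \<le> 5 * L * \<bar>s - t\<bar>" if "s \<in> {0..T}" "t \<in> {0..T}" for s t
  proof -
    have "\<bar>(\<integral>x. capped_sq N x \<partial>\<mu> s) - (\<integral>x. capped_sq N x \<partial>\<mu> t)\<bar> \<le> L * \<bar>s - t\<bar>"
      by (rule increment_abs_le[OF capped_sq_measurable capped_sq_bound that(2,1)])
        (use rate_bound(2)[OF _ capped_sq_measurable capped_sq_bound] in \<open>auto simp: L_def\<close>)
    then show ?thesis by (simp add: f_def abs_le_iff)
  qed
  have "f t \<le> f 0 * exp ((5 * \<Lambda> * M) * t)"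
  proof (rule gronwall_increments[where F = "\<lambda>_. f"])
    show "0 \<le> 5 * \<Lambda> * M" using \<Lambda>_nonneg M_pos by simp
    show "\<And>s t. s \<in> {0..T} \<Longrightarrow> t \<in> {0..T} \<Longrightarrow> \<bar>f s - f t\<bar> \<le> (5 * L) * \<bar>s - t\<bar>" by (rule lip)
    have "f (t + h) \<le> f t + 5 * \<Lambda> * M * h * f t + (25 * \<Lambda> * M * L) * h\<^sup>2"
      if th: "0 \<le> t" "0 \<le> h" "t + h \<le> T" for t h
    proof -
      have "(\<integral>x. capped_sq N x \<partial>\<mu> (t + h)) \<le> (\<integral>x. capped_sq N x \<partial>\<mu> t) + (t + h - t) * (\<Lambda> * M * (f t + 5 * L * h))"
      proof (rule increment_le[OF capped_sq_measurable capped_sq_bound])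
        fix s assume s: "s \<in> {t..t + h}"
        then have "\<bar>f s - f t\<bar> \<le> 5 * L * \<bar>s - t\<bar>" using th by (intro lip) auto
        also have "\<dots> \<le> 5 * L * h" using s \<Lambda>_nonneg by (intro mult_left_mono) (auto simp: L_def)
        finally have "f s \<le> f t + 5 * L * h" by linarith
        then have "\<Lambda> * M * f s \<le> \<Lambda> * M * (f t + 5 * L * h)"
          using \<Lambda>_nonneg M_pos by (intro mult_left_mono) auto
        then show "rate (capped_sq N) s \<le> \<Lambda> * M * (f t + 5 * L * h)"
          using rate_capped_sq_le[of s N] s th by (auto simp: f_def)
      qed (use th in auto)
      then show ?thesis by (simp add: f_def algebra_simps power2_eq_square)
    qed
    then show "\<exists>c h\<^sub>0. 0 < h\<^sub>0 \<and> (\<forall>t h. 0 \<le> t \<longrightarrow> 0 \<le> h \<longrightarrow> h \<le> h\<^sub>0 \<longrightarrow> t + h \<le> T \<longrightarrow>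
                  f (t + h) \<le> f t + (5 * \<Lambda> * M) * h * f t + c * h\<^sup>2)"
      by (intro exI[of _ "25 * \<Lambda> * M * L"] exI[of _ 1]) auto
  qed (use t in auto)
  then show ?thesis by (simp add: f_def)
qed

text \<open>Uniformity in N lets monotone convergence remove the cap; 2 + 2 * Q comes from (1 + k)^2
  \<le> 2 + 2 * k^2.\<close>

lemma second_moment_bound:
  "\<exists>S. \<forall>t\<in>{0..T}. integrable (\<mu> t) (\<lambda>x. (wt x)\<^sup>2) \<and> (\<integral>x. (wt x)\<^sup>2 \<partial>\<mu> t) \<le> S"
proof -
  have z: "0 \<in> {0..T}" using T_nonneg by simp
  have sq: "(\<lambda>x. (real (snd x))\<^sup>2) \<in> borel_measurable state_space" by measurable
  have i0: "integrable (\<mu> 0) (\<lambda>x. (real (snd x))\<^sup>2)"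
    by (rule integrableI_nonneg) (use second_moment sq z in \<open>auto simp: measurable_\<mu>\<close>)
  define Q where "Q = (1 + 5 * (\<integral>x. (real (snd x))\<^sup>2 \<partial>\<mu> 0)) * exp (5 * \<Lambda> * M * T)"
  have "integrable (\<mu> t) (\<lambda>x. (wt x)\<^sup>2) \<and> (\<integral>x. (wt x)\<^sup>2 \<partial>\<mu> t) \<le> 2 + 2 * Q" if t: "t \<in> {0..T}" for t
  proof -
    interpret P: prob_space "\<mu> t" using t by (rule \<mu>_prob)
    have le: "(\<integral>x. capped_sq N x \<partial>\<mu> t) \<le> Q" for N
    proof -
      have "(\<integral>x. capped_sq N x \<partial>\<mu> 0) \<le> (\<integral>x. (real (snd x))\<^sup>2 \<partial>\<mu> 0)"
        by (rule integral_mono[OF integrable_bounded[OF z capped_sq_measurable capped_sq_bound] i0])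
          (auto simp: capped_sq_def intro!: power_mono)
      moreover have "0 \<le> (\<integral>x. (real (snd x))\<^sup>2 \<partial>\<mu> 0)" by (rule integral_nonneg_AE) simp
      ultimately have "(1 + 5 * (\<integral>x. capped_sq N x \<partial>\<mu> 0)) * exp (5 * \<Lambda> * M * t) \<le> Q"
        unfolding Q_def using t \<Lambda>_nonneg M_pos by (intro mult_mono) (auto intro!: mult_left_mono)
      moreover have "0 \<le> (\<integral>x. capped_sq N x \<partial>\<mu> t)" by (rule integral_nonneg_AE) (simp add: capped_sq_def)
      ultimately show ?thesis using integral_capped_sq_le[OF t, of N] by linarith
    qed
    have "0 \<le> (\<integral>x. (real (snd x))\<^sup>2 \<partial>\<mu> 0)" by (rule integral_nonneg_AE) simp
    then have Q0: "0 \<le> Q" by (simp add: Q_def)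
    have lim: "(\<lambda>N. \<integral>\<^sup>+ x. ennreal (capped_sq N x) \<partial>\<mu> t) \<longlonglongrightarrow> (\<integral>\<^sup>+ x. ennreal ((real (snd x))\<^sup>2) \<partial>\<mu> t)"
    proof (rule nn_integral_LIMSEQ)
      show "incseq (\<lambda>N x. ennreal (capped_sq N x))"
        by (auto simp: incseq_def le_fun_def capped_sq_def intro!: ennreal_leI power_mono)
      show "(\<lambda>x. ennreal (capped_sq N x)) \<in> borel_measurable (\<mu> t)" for N
        using capped_sq_measurable t by (auto simp: measurable_\<mu>)
      fix x :: "real \<times> nat"
      have "\<forall>\<^sub>F N in sequentially. ennreal (capped_sq N x) = ennreal ((real (snd x))\<^sup>2)"
        by (rule eventually_sequentiallyI[of "snd x"]) (simp add: capped_sq_def)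
      then show "(\<lambda>N. ennreal (capped_sq N x)) \<longlonglongrightarrow> ennreal ((real (snd x))\<^sup>2)"
        by (rule tendsto_eventually)
    qed
    have "(\<integral>\<^sup>+ x. ennreal (capped_sq N x) \<partial>\<mu> t) \<le> ennreal Q" for N
      using le[of N] by (subst nn_integral_eq_integral[OF integrable_bounded[OF t capped_sq_measurable capped_sq_bound]])
        (auto simp: capped_sq_nonneg intro!: ennreal_leI)
    then have nn: "(\<integral>\<^sup>+ x. ennreal ((real (snd x))\<^sup>2) \<partial>\<mu> t) \<le> ennreal Q"
      by (intro LIMSEQ_le_const2[OF lim]) auto
    have i: "integrable (\<mu> t) (\<lambda>x. (real (snd x))\<^sup>2)"
      by (rule integrableI_nonneg) (use nn sq t in \<open>auto simp: measurable_\<mu> intro: le_less_trans\<close>)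
    have iQ: "(\<integral>x. (real (snd x))\<^sup>2 \<partial>\<mu> t) \<le> Q"
      using nn nn_integral_eq_integral[OF i] Q0 by simp
    have w2: "(wt x)\<^sup>2 \<le> 2 + 2 * (real (snd x))\<^sup>2" for x
      using sum_squares_bound[of 1 "real (snd x)"] by (simp add: wt_def power2_sum)
    have iw: "integrable (\<mu> t) (\<lambda>x. (wt x)\<^sup>2)"
    proof (rule Bochner_Integration.integrable_bound)
      show "integrable (\<mu> t) (\<lambda>x. 2 + 2 * (real (snd x))\<^sup>2)" using i by simp
      show "(\<lambda>x. (wt x)\<^sup>2) \<in> borel_measurable (\<mu> t)" unfolding measurable_\<mu>[OF t] by measurable
    qed (use w2 in auto)
    have "(\<integral>x. (wt x)\<^sup>2 \<partial>\<mu> t) \<le> (\<integral>x. 2 + 2 * (real (snd x))\<^sup>2 \<partial>\<mu> t)"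
      by (rule integral_mono[OF iw]) (use i w2 in auto)
    also have "\<dots> \<le> 2 + 2 * Q" using i iQ by (simp add: P.prob_space)
    finally show ?thesis using iw by simp
  qed
  then show ?thesis by blast
qed

text \<open>Choosing one bound once and for all lets the constants \<open>lip\<close> and
  \<open>C2\<close> be closed terms.\<close>

definition S2 :: real where
  "S2 = (SOME S. \<forall>t\<in>{0..T}. integrable (\<mu> t) (\<lambda>x. (wt x)\<^sup>2) \<and> (\<integral>x. (wt x)\<^sup>2 \<partial>\<mu> t) \<le> S)"

lemma integrable_wt_sq:
  assumes "t \<in> {0..T}"
  shows "integrable (\<mu> t) (\<lambda>x. (wt x)\<^sup>2)" "(\<integral>x. (wt x)\<^sup>2 \<partial>\<mu> t) \<le> S2"
  using someI_ex[OF second_moment_bound] assms unfolding S2_def by blast+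

text \<open>5 = 2 + 3: for |f| \<le> wt a loss changes f by at most 2 * wt and a gain by at most 3 *
  wt, since an upward step at most doubles \<open>wt\<close>. With the rate, each variable carries
  the square of \<open>wt\<close>, hence the square of \<open>S2\<close>.\<close>

definition lip :: real where "lip = 5 * \<Lambda> * S2\<^sup>2"

lemma lip_nonneg: "0 \<le> lip"
  using \<Lambda>_nonneg by (simp add: lip_def)

text \<open>The equation is applied to the truncations of f at level K, whose rates have a bound
  independent of K thanks to the second moments; dominated convergence with majorant c * wt removes
  the truncation.\<close>

lemma integral_lipschitz:
  assumes m: "f \<in> borel_measurable state_space"
    and b: "\<And>x. x \<in> space state_space \<Longrightarrow> \<bar>f x\<bar> \<le> c * wt x"
    and t: "t \<in> {0..T}" "t' \<in> {0..T}"
  shows "\<bar>(\<integral>x. f x \<partial>\<mu> t') - (\<integral>x. f x \<partial>\<mu> t)\<bar> \<le> c * lip * \<bar>t' - t\<bar>"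
proof -
  note m[measurable]
  have c0: "0 \<le> c" using b[of "(0, 0)"] by (simp add: space_state_space wt_def)
  define g where "g K x = (if snd x \<le> K then f x else 0)" for K and x :: "real \<times> nat"
  have mg[measurable]: "g K \<in> borel_measurable state_space" for K
    unfolding g_def by measurable
  have bg: "\<bar>g K x\<bar> \<le> c * wt x" if "x \<in> space state_space" for K x
    using b[OF that] c0 wt_ge_1[of x] by (auto simp: g_def)
  have bg': "\<bar>g K x\<bar> \<le> c * (1 + real K)" if "x \<in> space state_space" for K x
    using b[OF that] c0 mult_left_mono[of "wt x" "1 + real K" c] by (auto simp: g_def wt_def)
  have rate_le: "\<bar>rate (g K) s\<bar> \<le> c * lip" if s: "s \<in> {0..T}" for K s
  proof -
    have "\<bar>rate (g K) s\<bar> \<le> 5 * c * \<Lambda> * (\<integral>x. (wt x)\<^sup>2 \<partial>\<mu> s)\<^sup>2"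
      unfolding rate_def
    proof (rule integral_pair_bound(2)[OF sigma_finite_\<mu>[OF s] integrable_wt_sq(1)[OF s]])
      show "(\<lambda>z. R (fst z) (snd z) * jump (g K) (fst z) (snd z)) \<in> borel_measurable (\<mu> s \<Otimes>\<^sub>M \<mu> s)"
        unfolding measurable_\<mu>[OF s] by measurable
      fix x y assume "x \<in> space (\<mu> s)" "y \<in> space (\<mu> s)"
      then have x: "x \<in> space state_space" and y: "y \<in> space state_space"
        using s by (auto simp: space_\<mu>)
      have lose: "\<bar>lose (g K) x\<bar> \<le> 2 * (c * wt x)"
      proof -
        have "\<bar>g K (fst x, snd x - 1)\<bar> \<le> c * wt (fst x, snd x - 1)"
          by (rule bg[OF shift_in_space[OF x]])
        also have "\<dots> \<le> c * wt x" using c0 by (intro mult_left_mono) (auto simp: wt_def)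
        finally show ?thesis using bg[OF x, of K] by (auto simp: lose_def)
      qed
      have gain: "\<bar>gain (g K) y\<bar> \<le> 3 * (c * wt y)"
      proof -
        have "\<bar>g K (fst y, snd y + 1)\<bar> \<le> c * wt (fst y, snd y + 1)"
          by (rule bg[OF shift_in_space[OF y]])
        also have "\<dots> \<le> c * (2 * wt y)" using c0 by (intro mult_left_mono) (auto simp: wt_def)
        finally show ?thesis using bg[OF y, of K] by (auto simp: gain_def)
      qed
      have "c * wt x * 1 \<le> c * wt x * wt y" "c * wt y * 1 \<le> c * wt y * wt x"
        using c0 wt_ge_1[of x] wt_ge_1[of y] by (intro mult_left_mono; simp)+
      then have "\<bar>jump (g K) x y\<bar> \<le> 5 * c * (wt x * wt y)"
        using lose gain by (simp add: jump_eq algebra_simps)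
      then have "\<bar>R x y\<bar> * \<bar>jump (g K) x y\<bar> \<le> (\<Lambda> * (wt x * wt y)) * (5 * c * (wt x * wt y))"
        using \<Lambda>_nonneg wt_ge_1[of x] wt_ge_1[of y] by (intro mult_mono R_abs_le x y) auto
      then show "\<bar>R (fst (x, y)) (snd (x, y)) * jump (g K) (fst (x, y)) (snd (x, y))\<bar>
          \<le> 5 * c * \<Lambda> * ((wt x)\<^sup>2 * (wt y)\<^sup>2)"
        by (simp add: abs_mult power2_eq_square algebra_simps)
    qed
    also have "\<dots> \<le> 5 * c * \<Lambda> * S2\<^sup>2"
    proof -
      have "0 \<le> (\<integral>x. (wt x)\<^sup>2 \<partial>\<mu> s)" by (rule integral_nonneg_AE) simp
      then show ?thesis
        using integrable_wt_sq(2)[OF s] c0 \<Lambda>_nonneg by (intro mult_left_mono power_mono) auto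
    qed
    finally show ?thesis by (simp add: lip_def algebra_simps)
  qed
  have I: "(\<lambda>K. \<integral>x. g K x \<partial>\<mu> s) \<longlonglongrightarrow> (\<integral>x. f x \<partial>\<mu> s)" if s: "s \<in> {0..T}" for s
  proof (rule integral_dominated_convergence[where w = "\<lambda>x. c * wt x"])
    show "integrable (\<mu> s) (\<lambda>x. c * wt x)" using integrable_wt[OF s] by simp
    show "AE x in \<mu> s. (\<lambda>K. g K x) \<longlonglongrightarrow> f x"
    proof (rule AE_I2)
      fix x
      have "\<forall>\<^sub>F K in sequentially. g K x = f x"
        by (rule eventually_sequentiallyI[of "snd x"]) (simp add: g_def)
      then show "(\<lambda>K. g K x) \<longlonglongrightarrow> f x" by (rule tendsto_eventually)
    qed
  qed (use s m mg bg in \<open>auto simp: measurable_\<mu> space_\<mu>\<close>)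
  have "(\<lambda>K. \<bar>(\<integral>x. g K x \<partial>\<mu> t') - (\<integral>x. g K x \<partial>\<mu> t)\<bar>) \<longlonglongrightarrow> \<bar>(\<integral>x. f x \<partial>\<mu> t') - (\<integral>x. f x \<partial>\<mu> t)\<bar>"
    by (intro tendsto_intros I t)
  then show ?thesis
    by (rule LIMSEQ_le_const2)
      (use increment_abs_le[OF mg bg' t rate_le] in auto)
qed

end

section \<open>Sign of a difference of measures\<close>

text \<open>The density \<open>indicator Y\<close> turns a comparison on subsets of Y into one on
  all measurable sets, where the order on measures makes integrals monotone.\<close>

lemma integral_mono_measure_on:
  fixes f :: "'a \<Rightarrow> real"
  assumes sets: "sets N = sets M" and Y: "Y \<in> sets M"
    and le: "\<And>X. X \<in> sets M \<Longrightarrow> X \<subseteq> Y \<Longrightarrow> emeasure N X \<le> emeasure M X"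
    and f: "\<And>x. x \<in> space M \<Longrightarrow> 0 \<le> f x" "integrable M f" "integrable N f"
  shows "(\<integral>x. indicator Y x * f x \<partial>N) \<le> (\<integral>x. indicator Y x * f x \<partial>M)"
proof -
  have sp: "space N = space M" using sets by (rule sets_eq_imp_space_eq)
  have mf: "f \<in> borel_measurable M" "f \<in> borel_measurable N" using f by auto
  have iM: "integrable M (\<lambda>x. indicator Y x * f x)" and iN: "integrable N (\<lambda>x. indicator Y x * f x)"
    using integrable_mult_indicator[OF Y f(2)] integrable_mult_indicator[of Y N f] f(3) Y sets
    by simp_all
  have "density N (indicator Y) \<le> density M (indicator Y)"
  proof (subst le_measure)
    show "\<forall>A\<in>sets (density N (indicator Y)).
        emeasure (density N (indicator Y)) A \<le> emeasure (density M (indicator Y)) A"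
    proof
      fix A assume "A \<in> sets (density N (indicator Y))"
      then have A: "A \<in> sets M" by (simp add: sets)
      have "emeasure (density N (indicator Y)) A = emeasure N (Y \<inter> A)"
        using A Y sets by (intro emeasure_restricted) simp_all
      moreover have "emeasure (density M (indicator Y)) A = emeasure M (Y \<inter> A)"
        using A Y by (intro emeasure_restricted) simp_all
      moreover have "emeasure N (Y \<inter> A) \<le> emeasure M (Y \<inter> A)"
        using A Y by (intro le) auto
      ultimately show "emeasure (density N (indicator Y)) A \<le> emeasure (density M (indicator Y)) A"
        by simp
    qed
  qed (simp add: sets)
  then have "(\<integral>\<^sup>+x. ennreal (f x) \<partial>density N (indicator Y)) \<le> (\<integral>\<^sup>+x. ennreal (f x) \<partial>density M (indicator Y))"
    by (intro nn_integral_mono_measure) (simp_all add: sets)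
  moreover have "indicator Y x * ennreal (f x) = ennreal (indicator Y x * f x)" for x
    by (simp add: indicator_def)
  ultimately have "(\<integral>\<^sup>+x. ennreal (indicator Y x * f x) \<partial>N) \<le> (\<integral>\<^sup>+x. ennreal (indicator Y x * f x) \<partial>M)"
    using Y mf sets by (simp add: nn_integral_density)
  note nn_le = this
  have "ennreal (\<integral>x. indicator Y x * f x \<partial>N) \<le> ennreal (\<integral>x. indicator Y x * f x \<partial>M)"
  proof -
    have "AE x in M. 0 \<le> indicator Y x * f x" "AE x in N. 0 \<le> indicator Y x * f x"
      using f(1) sp by (auto intro!: AE_I2)
    then show ?thesis
      using nn_le nn_integral_eq_integral[OF iM] nn_integral_eq_integral[OF iN] by simp
  qed
  moreover have "0 \<le> (\<integral>x. indicator Y x * f x \<partial>M)"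
    using f(1) by (intro integral_nonneg_AE) auto
  ultimately show ?thesis by simp
qed

text \<open>The sign of the signed measure M - N, characterised by its use: testing M - N with
  \<sigma> f is integration of f against the total variation, a positive functional. The values are
  1 or -1 also off the carrier, so \<sigma>^2 = 1 holds as an identity of functions.\<close>

definition hahn_sign :: "'a measure \<Rightarrow> 'a measure \<Rightarrow> ('a \<Rightarrow> real) \<Rightarrow> bool" where
  "hahn_sign M N \<sigma> \<longleftrightarrow> \<sigma> \<in> borel_measurable M \<and> (\<forall>x. \<sigma> x = 1 \<or> \<sigma> x = -1) \<and>
     (\<forall>f. (\<forall>x\<in>space M. 0 \<le> f x) \<longrightarrow> integrable M f \<longrightarrow> integrable N f \<longrightarrow>
        (\<integral>x. \<sigma> x * f x \<partial>N) \<le> (\<integral>x. \<sigma> x * f x \<partial>M))"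

text \<open>\<sigma> is 1 on the positive set of a Hahn decomposition and -1 off it; the integrals
  over the two sets compare in opposite directions.\<close>

lemma hahn_sign_exists:
  assumes fin: "finite_measure M" "finite_measure N" and sets: "sets N = sets M"
  shows "\<exists>\<sigma>. hahn_sign M N \<sigma>"
proof -
  have sp: "space N = space M" using sets by (rule sets_eq_imp_space_eq)
  obtain Y where Y: "Y \<in> sets M"
    and le: "\<forall>X\<in>sets M. X \<subseteq> Y \<longrightarrow> emeasure N X \<le> emeasure M X"
    and ge: "\<forall>X\<in>sets M. X \<inter> Y = {} \<longrightarrow> emeasure M X \<le> emeasure N X"
    using finite_unsigned_Hahn_decomposition[OF fin sets] by (elim bexE conjE)
  define Z where "Z = space M - Y"
  have Z: "Z \<in> sets M" using Y by (simp add: Z_def)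
  define \<sigma> where "\<sigma> x = (if x \<in> Y then 1 else -1 :: real)" for x
  have m: "\<sigma> \<in> borel_measurable M" using Y unfolding \<sigma>_def by measurable
  have "(\<integral>x. \<sigma> x * f x \<partial>N) \<le> (\<integral>x. \<sigma> x * f x \<partial>M)"
    if f: "\<forall>x\<in>space M. 0 \<le> f x" "integrable M f" "integrable N f" for f
  proof -
    have split: "(\<integral>x. \<sigma> x * f x \<partial>L) = (\<integral>x. indicator Y x * f x \<partial>L) - (\<integral>x. indicator Z x * f x \<partial>L)"
      if L: "sets L = sets M" "integrable L f" for L
    proof -
      have i: "integrable L (\<lambda>x. indicator Y x * f x)" "integrable L (\<lambda>x. indicator Z x * f x)"
        using integrable_mult_indicator[of Y L f] integrable_mult_indicator[of Z L f] L Y Z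
        by simp_all
      have "(\<integral>x. \<sigma> x * f x \<partial>L) = (\<integral>x. indicator Y x * f x - indicator Z x * f x \<partial>L)"
        using sets_eq_imp_space_eq[OF L(1)]
        by (intro Bochner_Integration.integral_cong) (auto simp: \<sigma>_def Z_def)
      then show ?thesis using i by simp
    qed
    have "(\<integral>x. indicator Y x * f x \<partial>N) \<le> (\<integral>x. indicator Y x * f x \<partial>M)"
      using f le by (intro integral_mono_measure_on[OF sets Y]) auto
    moreover have "(\<integral>x. indicator Z x * f x \<partial>M) \<le> (\<integral>x. indicator Z x * f x \<partial>N)"
    proof (rule integral_mono_measure_on)
      show "emeasure M X \<le> emeasure N X" if "X \<in> sets N" "X \<subseteq> Z" for X
        using that ge sets by (auto simp: Z_def)
    qed (use f Z sets sp in auto)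
    ultimately show ?thesis using split[of M] split[of N] f sets by simp
  qed
  then show ?thesis using m unfolding hahn_sign_def by (intro exI[of _ \<sigma>]) (auto simp: \<sigma>_def)
qed

text \<open>Subtraction of natural numbers supplies the positive part of K - k. The tent agrees with
  \<open>wt\<close> as long as 2 * k + 1 \<le> K and vanishes from level K on.\<close>

definition cutw :: "nat \<Rightarrow> real \<times> nat \<Rightarrow> real" where
  "cutw K x = real (min (1 + snd x) (K - snd x))"

lemma cutw_measurable [measurable]: "cutw K \<in> borel_measurable state_space"
  unfolding cutw_def by measurable

lemma cutw_nonneg: "0 \<le> cutw K x" and cutw_le: "cutw K x \<le> wt x" "cutw K x \<le> real K"
  by (auto simp: cutw_def wt_def)

lemma cutw_eq_0: "K \<le> snd x \<Longrightarrow> cutw K x = 0"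
  by (simp add: cutw_def)

text \<open>This is the reason for a tent: a weight cut off sharply at K would change by order K in
  one jump, and rates of order K would turn this into an error of order K^2.\<close>

lemma cutw_step: "cutw K (u, Suc k) \<le> cutw K (u, k) + 1" "cutw K (u, k) \<le> cutw K (u, Suc k) + 1"
proof -
  have "min (1 + Suc k) (K - Suc k) \<le> min (1 + k) (K - k) + 1"
    "min (1 + k) (K - k) \<le> min (1 + Suc k) (K - Suc k) + 1" by auto
  then show "cutw K (u, Suc k) \<le> cutw K (u, k) + 1" "cutw K (u, k) \<le> cutw K (u, Suc k) + 1"
    unfolding cutw_def snd_conv by linarith+
qed

section \<open>The linearised generator\<close>

context jump_rates
begin

text \<open>The two particles are exchanged in the gain half, so that both increments of \<psi> are
  taken at x; y survives only in the rates and can be integrated out.\<close>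

definition kern :: "(real \<times> nat \<Rightarrow> real) \<Rightarrow> real \<times> nat \<Rightarrow> real \<times> nat \<Rightarrow> real" where
  "kern \<psi> x y = R x y * lose \<psi> x + R y x * gain \<psi> x"

lemma kern_measurable [measurable (raw)]:
  assumes \<psi>: "\<psi> \<in> borel_measurable state_space"
    and f: "f \<in> N \<rightarrow>\<^sub>M state_space" and g: "g \<in> N \<rightarrow>\<^sub>M state_space"
  shows "(\<lambda>z. kern \<psi> (f z) (g z)) \<in> borel_measurable N"
  unfolding kern_def
  by (intro borel_measurable_add borel_measurable_times R_measurable2 f g
      measurable_compose[OF f lose_measurable[OF \<psi>]] measurable_compose[OF f gain_measurable[OF \<psi>]])

text \<open>The bound is linear in y, so integration over y against the signed difference costs only
  the weighted total variation; the quadratic weight in x calls for a second moment.\<close>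

lemma kern_bound:
  assumes b: "\<And>x. x \<in> space state_space \<Longrightarrow> \<bar>\<psi> x\<bar> \<le> wt x"
    and x: "x \<in> space state_space" and y: "y \<in> space state_space"
  shows "\<bar>kern \<psi> x y\<bar> \<le> 5 * \<Lambda> * (wt x)\<^sup>2 * wt y"
proof -
  have "\<bar>\<psi> (fst x, snd x - 1)\<bar> \<le> wt x"
    using b[OF shift_in_space[OF x], of "snd x - 1"] by (simp add: wt_def)
  then have l: "\<bar>lose \<psi> x\<bar> \<le> 2 * wt x" using b[OF x] by (auto simp: lose_def)
  have "\<bar>\<psi> (fst x, snd x + 1)\<bar> \<le> 1 + wt x"
    using b[OF shift_in_space[OF x], of "snd x + 1"] by (simp add: wt_def)
  then have g: "\<bar>gain \<psi> x\<bar> \<le> 3 * wt x" using b[OF x] wt_ge_1[of x] by (auto simp: gain_def)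
  have "\<bar>R x y\<bar> * \<bar>lose \<psi> x\<bar> \<le> (\<Lambda> * (wt x * wt y)) * (2 * wt x)"
    "\<bar>R y x\<bar> * \<bar>gain \<psi> x\<bar> \<le> (\<Lambda> * (wt y * wt x)) * (3 * wt x)"
    using \<Lambda>_nonneg wt_ge_1[of x] wt_ge_1[of y] l g by (intro mult_mono R_abs_le x y; simp)+
  then have "\<bar>R x y * lose \<psi> x\<bar> + \<bar>R y x * gain \<psi> x\<bar> \<le> 5 * \<Lambda> * (wt x)\<^sup>2 * wt y"
    by (simp add: abs_mult power2_eq_square algebra_simps)
  then show ?thesis unfolding kern_def by linarith
qed

text \<open>A function dominated by the tent vanishes from level K on. At level K a loss still
  reaches K - 1, where \<psi> may be nonzero; above K both neighbours lie in the zero region, so the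
  kernel is 0.\<close>

lemma kern_cut_bound:
  assumes b: "\<And>x. x \<in> space state_space \<Longrightarrow> \<bar>\<psi> x\<bar> \<le> cutw K x"
    and x: "x \<in> space state_space" and y: "y \<in> space state_space"
  shows "\<bar>kern \<psi> x y\<bar> \<le> 5 * \<Lambda> * (1 + real K)\<^sup>2 * wt y"
proof (cases "snd x \<le> K")
  case True
  have "\<bar>kern \<psi> x y\<bar> \<le> 5 * \<Lambda> * (wt x)\<^sup>2 * wt y"
    by (rule kern_bound[OF _ x y]) (use b cutw_le(1) order_trans in blast)
  also have "\<dots> \<le> 5 * \<Lambda> * (1 + real K)\<^sup>2 * wt y"
    using True \<Lambda>_nonneg wt_ge_1[of y]
    by (intro mult_right_mono mult_left_mono power_mono) (auto simp: wt_def)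
  finally show ?thesis .
next
  case False
  have "\<psi> (fst x, j) = 0" if "K \<le> j" for j
    using b[OF shift_in_space[OF x], of j] cutw_eq_0[of K "(fst x, j)"] that by simp
  then have "lose \<psi> x = 0" "gain \<psi> x = 0"
    using False by (auto simp: lose_def gain_def) (metis le_Suc_eq less_imp_le_nat not_le prod.collapse)+
  then show ?thesis using \<Lambda>_nonneg wt_ge_1[of y] by (simp add: kern_def)
qed

end

context jump_solution
begin

definition gen :: "real \<Rightarrow> (real \<times> nat \<Rightarrow> real) \<Rightarrow> real \<times> nat \<Rightarrow> real" where
  "gen t \<psi> x = (\<integral>y. kern \<psi> x y \<partial>\<mu> t)"

lemma gen_measurable:
  assumes \<psi>: "\<psi> \<in> borel_measurable state_space" and t: "t \<in> {0..T}"
  shows "gen t \<psi> \<in> borel_measurable state_space"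
proof -
  interpret sigma_finite_measure "\<mu> t" using t by (rule sigma_finite_\<mu>)
  have "(\<lambda>z. kern \<psi> (fst z) (snd z)) \<in> borel_measurable (state_space \<Otimes>\<^sub>M \<mu> t)"
    unfolding measurable_cong_sets[OF sets_pair_measure_cong[OF refl sets_\<mu>[OF t]] refl]
    by (rule kern_measurable[OF \<psi>]) auto
  then show ?thesis
    unfolding gen_def[abs_def] by (intro borel_measurable_lebesgue_integral) (simp add: split_beta)
qed

lemma rate_eq_gen:
  assumes \<psi>: "\<psi> \<in> borel_measurable state_space"
    and b: "\<And>x. x \<in> space state_space \<Longrightarrow> \<bar>\<psi> x\<bar> \<le> b" and t: "t \<in> {0..T}"
  shows "rate \<psi> t = (\<integral>x. gen t \<psi> x \<partial>\<mu> t)"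
proof -
  interpret S: sigma_finite_measure "\<mu> t" using t by (rule sigma_finite_\<mu>)
  interpret P: pair_sigma_finite "\<mu> t" "\<mu> t" ..
  let ?N = "\<mu> t \<Otimes>\<^sub>M \<mu> t"
  have "0 \<le> b" using b[of "(0, 0)"] by (simp add: space_state_space)
  \<comment> \<open>One statement for three integrands, with the roles of the variables passed as f,
    g and h; \<open>fg\<close> says that a swap leaves the majorant wt x * wt y unchanged.\<close>
  have bound: "integrable ?N (\<lambda>z. R (f z) (g z) * e (h z))"
    if "f \<in> (state_space \<Otimes>\<^sub>M state_space) \<rightarrow>\<^sub>M state_space"
      "g \<in> (state_space \<Otimes>\<^sub>M state_space) \<rightarrow>\<^sub>M state_space"
      "h \<in> (state_space \<Otimes>\<^sub>M state_space) \<rightarrow>\<^sub>M state_space"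
      and e: "e \<in> borel_measurable state_space" "\<And>x. x \<in> space state_space \<Longrightarrow> \<bar>e x\<bar> \<le> 2 * b"
      and fg: "\<And>x y. wt (f (x, y)) * wt (g (x, y)) = wt x * wt y"
    for f g h e
  proof (rule integral_pair_bound(1)[OF sigma_finite_\<mu>[OF t] integrable_wt(1)[OF t]])
    show "(\<lambda>z. R (f z) (g z) * e (h z)) \<in> borel_measurable ?N"
      unfolding measurable_\<mu>[OF t] using that
      by (intro borel_measurable_times R_measurable2 measurable_compose[OF that(3) e(1)])
    fix x y assume "x \<in> space (\<mu> t)" "y \<in> space (\<mu> t)"
    then have "(x, y) \<in> space (state_space \<Otimes>\<^sub>M state_space)"
      using t by (simp add: space_pair_measure space_\<mu>)
    then have sp: "f (x, y) \<in> space state_space" "g (x, y) \<in> space state_space" "h (x, y) \<in> space state_space"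
      using that(1-3) by (auto dest: measurable_space)
    have "\<bar>R (f (x, y)) (g (x, y))\<bar> \<le> \<Lambda> * (wt x * wt y)"
      using R_abs_le[OF sp(1,2)] by (simp add: fg)
    then have "\<bar>R (f (x, y)) (g (x, y))\<bar> * \<bar>e (h (x, y))\<bar> \<le> (\<Lambda> * (wt x * wt y)) * (2 * b)"
      using \<Lambda>_nonneg wt_ge_1[of x] wt_ge_1[of y] by (intro mult_mono e(2) sp(3)) simp_all
    then show "\<bar>R (f (x, y)) (g (x, y)) * e (h (x, y))\<bar> \<le> (2 * b * \<Lambda>) * (wt x * wt y)"
      by (simp add: abs_mult algebra_simps)
  qed
  have m: "fst \<in> (state_space \<Otimes>\<^sub>M state_space) \<rightarrow>\<^sub>M state_space"
    "snd \<in> (state_space \<Otimes>\<^sub>M state_space) \<rightarrow>\<^sub>M state_space" by auto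
  have i1: "integrable ?N (\<lambda>z. R (fst z) (snd z) * lose \<psi> (fst z))"
    by (rule bound[OF m m(1) lose_measurable[OF \<psi>] lose_bound[OF b]]) auto
  have i2: "integrable ?N (\<lambda>z. R (fst z) (snd z) * gain \<psi> (snd z))"
    by (rule bound[OF m m(2) gain_measurable[OF \<psi>] gain_bound[OF b]]) auto
  have i3: "integrable ?N (\<lambda>z. R (snd z) (fst z) * gain \<psi> (fst z))"
    by (rule bound[OF m(2,1,1) gain_measurable[OF \<psi>] gain_bound[OF b]]) auto
  have "rate \<psi> t = (\<integral>z. R (fst z) (snd z) * lose \<psi> (fst z) + R (fst z) (snd z) * gain \<psi> (snd z) \<partial>?N)"
    unfolding rate_def jump_eq by (simp add: algebra_simps)
  also have "\<dots> = (\<integral>z. R (fst z) (snd z) * lose \<psi> (fst z) \<partial>?N) + (\<integral>z. R (fst z) (snd z) * gain \<psi> (snd z) \<partial>?N)"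
    using i1 i2 by simp
  also have "(\<integral>z. R (fst z) (snd z) * gain \<psi> (snd z) \<partial>?N) = (\<integral>z. R (snd z) (fst z) * gain \<psi> (fst z) \<partial>?N)"
    using P.integral_product_swap[OF borel_measurable_integrable[OF i2]] by (simp add: case_prod_unfold)
  also have "(\<integral>z. R (fst z) (snd z) * lose \<psi> (fst z) \<partial>?N) + (\<integral>z. R (snd z) (fst z) * gain \<psi> (fst z) \<partial>?N) =
      (\<integral>z. kern \<psi> (fst z) (snd z) \<partial>?N)"
    unfolding kern_def using i1 i3 by simp
  also have "\<dots> = (\<integral>x. gen t \<psi> x \<partial>\<mu> t)"
    using P.integral_fst'[of "\<lambda>z. kern \<psi> (fst z) (snd z)"] i1 i3 by (simp add: gen_def kern_def)
  finally show ?thesis .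
qed

end

section \<open>Weighted total variation\<close>

context jump_solution
begin

definition out_rate :: "real \<Rightarrow> real \<times> nat \<Rightarrow> real" where
  "out_rate t x = (\<integral>y. R x y \<partial>\<mu> t)"

definition in_rate :: "real \<Rightarrow> real \<times> nat \<Rightarrow> real" where
  "in_rate t x = (\<integral>y. R y x \<partial>\<mu> t)"

lemma R_section_measurable:
  assumes "x \<in> space state_space"
  shows "R x \<in> borel_measurable state_space" "(\<lambda>y. R y x) \<in> borel_measurable state_space"
  by (rule R_measurable2[OF measurable_const[OF assms] measurable_ident, simplified]
      R_measurable2[OF measurable_ident measurable_const[OF assms], simplified])+

lemma integrable_R_section:
  assumes t: "t \<in> {0..T}" and x: "x \<in> space state_space"
  shows "integrable (\<mu> t) (R x)" "integrable (\<mu> t) (\<lambda>y. R y x)"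
  by (rule integrable_le_wt[OF t, where c = "\<Lambda> * wt x"];
      use R_section_measurable[OF x] R_abs_le[OF x] R_abs_le[OF _ x] in \<open>simp add: mult_ac\<close>)+

lemma gen_eq:
  assumes t: "t \<in> {0..T}" and x: "x \<in> space state_space"
  shows "gen t \<psi> x = out_rate t x * lose \<psi> x + in_rate t x * gain \<psi> x"
  using integrable_R_section[OF t x] by (simp add: gen_def kern_def out_rate_def in_rate_def)

lemma rates_bound:
  assumes t: "t \<in> {0..T}" and x: "x \<in> space state_space"
  shows "0 \<le> out_rate t x" "0 \<le> in_rate t x" "out_rate t x \<le> \<Lambda> * (1 + M) * wt x"
    "in_rate t x \<le> \<Lambda> * (1 + M) * wt x" "snd x = 0 \<Longrightarrow> out_rate t x = 0"
proof -
  note iw = integrable_wt[OF t]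
  show "0 \<le> out_rate t x" "0 \<le> in_rate t x"
    unfolding out_rate_def in_rate_def using t x
    by (auto intro!: integral_nonneg_AE AE_I2 R_nonneg simp: space_\<mu>)
  have "(\<integral>y. \<Lambda> * wt x * wt y \<partial>\<mu> t) \<le> \<Lambda> * (1 + M) * wt x"
    using iw \<Lambda>_nonneg wt_ge_1[of x] mult_left_mono[OF iw(2), of "\<Lambda> * wt x"] by (simp add: mult_ac)
  moreover have "out_rate t x \<le> (\<integral>y. \<Lambda> * wt x * wt y \<partial>\<mu> t)" "in_rate t x \<le> (\<integral>y. \<Lambda> * wt x * wt y \<partial>\<mu> t)"
  proof -
    have i: "integrable (\<mu> t) (\<lambda>y. \<Lambda> * wt x * wt y)" using iw by simp
    have le: "R x y \<le> \<Lambda> * wt x * wt y" "R y x \<le> \<Lambda> * wt x * wt y" if "y \<in> space (\<mu> t)" for y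
      using R_abs_le[OF x, of y] R_abs_le[OF _ x, of y] that t by (simp_all add: space_\<mu> mult_ac)
    show "out_rate t x \<le> (\<integral>y. \<Lambda> * wt x * wt y \<partial>\<mu> t)" "in_rate t x \<le> (\<integral>y. \<Lambda> * wt x * wt y \<partial>\<mu> t)"
      unfolding out_rate_def in_rate_def
      by (intro integral_mono i integrable_R_section t x le; assumption)+
  qed
  ultimately show "out_rate t x \<le> \<Lambda> * (1 + M) * wt x" "in_rate t x \<le> \<Lambda> * (1 + M) * wt x"
    by linarith+
  assume "snd x = 0"
  then have "R x y = 0" if "y \<in> space state_space" for y
    using R_nonneg[OF x that] R_le[OF x that] by simp
  then have "out_rate t x = (\<integral>y. 0 \<partial>\<mu> t)"
    unfolding out_rate_def using t by (intro Bochner_Integration.integral_cong) (auto simp: space_\<mu>)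
  then show "out_rate t x = 0" by simp
qed

text \<open>Bounds the total jump rate \<open>out_rate\<close> + \<open>in_rate\<close> relative to
  \<open>wt\<close>; each of the two contributes \<Lambda> * (1 + M).\<close>

definition C1 :: real where "C1 = 2 * \<Lambda> * (1 + M)"

lemma C1_nonneg: "0 \<le> C1"
  using \<Lambda>_nonneg M_pos by (simp add: C1_def)

text \<open>With a and b' the masses moved by a loss and a gain in time h, the left side is the
  modulus of (1 - a - b') * \<psi> x + a * p + b' * q. For k < K the smallness of h makes 1 - a - b'
  nonnegative, and elsewhere \<psi> x = 0. Since p and q are effectively at most cutw K x + 1, the
  masses recombine to cutw K x and the excess is a + b' \<le> h * C1 * wt x.\<close>

lemma euler_step_bound:
  assumes b: "\<And>x. x \<in> space state_space \<Longrightarrow> \<bar>\<psi> x\<bar> \<le> cutw K x"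
    and t: "t \<in> {0..T}" and x: "x \<in> space state_space"
    and h: "0 \<le> h" "h * (C1 * (1 + real K)) \<le> 1"
  shows "\<bar>\<psi> x + h * gen t \<psi> x\<bar> \<le> cutw K x + h * C1 * wt x"
proof -
  obtain u k where xk: "x = (u, k)" by (cases x)
  define a where "a = h * out_rate t x"
  define b' where "b' = h * in_rate t x"
  define p where "p = (if k = 0 then 0 else \<psi> (u, k - 1))"
  define q where "q = \<psi> (u, k + 1)"
  note r = rates_bound[OF t x]
  have a0: "0 \<le> a" and b0: "0 \<le> b'" using r h by (auto simp: a_def b'_def)
  have "h * out_rate t x \<le> h * (\<Lambda> * (1 + M) * wt x)" "h * in_rate t x \<le> h * (\<Lambda> * (1 + M) * wt x)"
    using r h by (auto intro: mult_left_mono)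
  then have ab: "a + b' \<le> h * C1 * wt x" by (simp add: a_def b'_def C1_def algebra_simps)
  have "\<psi> x + h * gen t \<psi> x = (1 - a - b') * \<psi> x + a * p + b' * q"
    unfolding gen_eq[OF t x] by (simp add: a_def b'_def p_def q_def lose_def gain_def xk algebra_simps)
  then have 1: "\<bar>\<psi> x + h * gen t \<psi> x\<bar> \<le> \<bar>1 - a - b'\<bar> * \<bar>\<psi> x\<bar> + a * \<bar>p\<bar> + b' * \<bar>q\<bar>"
    using a0 b0 abs_triangle_ineq[of "(1 - a - b') * \<psi> x + a * p" "b' * q"]
      abs_triangle_ineq[of "(1 - a - b') * \<psi> x" "a * p"] by (simp add: abs_mult)
  have 2: "\<bar>1 - a - b'\<bar> * \<bar>\<psi> x\<bar> \<le> (1 - a - b') * cutw K x"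
  proof (cases "k < K")
    case True
    have "h * C1 * wt x \<le> h * C1 * (1 + real K)"
      using True h C1_nonneg by (intro mult_left_mono) (auto simp: wt_def xk)
    then have "0 \<le> 1 - a - b'" using ab h by (simp add: algebra_simps)
    then show ?thesis using b[OF x] by (auto intro: mult_left_mono)
  next
    case False
    then have "cutw K x = 0" by (simp add: cutw_eq_0 xk)
    then show ?thesis using b[OF x] by simp
  qed
  have 3: "a * \<bar>p\<bar> \<le> a * (cutw K x + 1)"
  proof (cases k)
    case (Suc j)
    have "\<bar>p\<bar> \<le> cutw K (u, j)" using b[OF shift_in_space[OF x], of j] Suc by (simp add: p_def xk)
    then show ?thesis using cutw_step(2)[of K u j] Suc a0 by (intro mult_left_mono) (auto simp: xk)
  qed (use r(5) in \<open>simp add: a_def xk\<close>)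
  have "\<bar>q\<bar> \<le> cutw K (u, Suc k)" using b[OF shift_in_space[OF x], of "Suc k"] by (simp add: q_def xk)
  then have 4: "b' * \<bar>q\<bar> \<le> b' * (cutw K x + 1)"
    using cutw_step(1)[of K u k] b0 by (intro mult_left_mono) (auto simp: xk)
  show ?thesis using 1 2 3 4 ab by (simp add: algebra_simps)
qed

lemma gen_cut_bound:
  assumes b: "\<And>x. x \<in> space state_space \<Longrightarrow> \<bar>\<psi> x\<bar> \<le> cutw K x"
    and t: "t \<in> {0..T}" and x: "x \<in> space state_space"
  shows "\<bar>gen t \<psi> x\<bar> \<le> 5 * \<Lambda> * (1 + real K)\<^sup>2 * (1 + M)"
proof -
  have "\<bar>gen t \<psi> x\<bar> \<le> (\<integral>y. \<bar>kern \<psi> x y\<bar> \<partial>\<mu> t)"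
    unfolding gen_def by (rule integral_abs_bound)
  also have "\<dots> \<le> (\<integral>y. 5 * \<Lambda> * (1 + real K)\<^sup>2 * wt y \<partial>\<mu> t)"
    using integrable_wt[OF t] t \<Lambda>_nonneg wt_ge_1
    by (intro integral_mono') (auto simp: space_\<mu> intro!: kern_cut_bound[OF b x] mult_nonneg_nonneg
        order_trans[OF zero_le_one wt_ge_1])
  also have "\<dots> \<le> 5 * \<Lambda> * (1 + real K)\<^sup>2 * (1 + M)"
    using integrable_wt[OF t] \<Lambda>_nonneg by (auto intro!: mult_left_mono)
  finally show ?thesis .
qed

end

text \<open>Measurable functions of linear growth: bounded first moments make them integrable
  against every \<open>\<mu> t\<close> and \<open>\<nu> t\<close>, so that the functionals
  \<open>diff\<close> and \<open>tv\<close> are additive on them.\<close>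

definition admissible :: "(real \<times> nat \<Rightarrow> real) \<Rightarrow> bool" where
  "admissible f \<longleftrightarrow> f \<in> borel_measurable state_space \<and>
     (\<exists>c. \<forall>x\<in>space state_space. \<bar>f x\<bar> \<le> c * wt x)"

lemma admissibleI:
  "f \<in> borel_measurable state_space \<Longrightarrow> (\<And>x. x \<in> space state_space \<Longrightarrow> \<bar>f x\<bar> \<le> c * wt x) \<Longrightarrow> admissible f"
  unfolding admissible_def by blast

lemma admissible_bounded:
  assumes "f \<in> borel_measurable state_space" "\<And>x. x \<in> space state_space \<Longrightarrow> \<bar>f x\<bar> \<le> c"
  shows "admissible f"
proof (rule admissibleI[OF assms(1)])
  fix x assume "x \<in> space state_space"
  from assms(2)[OF this] show "\<bar>f x\<bar> \<le> c * wt x"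
    using mult_left_mono[OF wt_ge_1[of x], of c] by linarith
qed

lemma admissible_add [intro]:
  assumes "admissible f" "admissible g"
  shows "admissible (\<lambda>x. f x + g x)"
proof -
  obtain c d where "\<forall>x\<in>space state_space. \<bar>f x\<bar> \<le> c * wt x" "\<forall>x\<in>space state_space. \<bar>g x\<bar> \<le> d * wt x"
    using assms unfolding admissible_def by blast
  then have "\<bar>f x + g x\<bar> \<le> (c + d) * wt x" if "x \<in> space state_space" for x
    using that abs_triangle_ineq[of "f x" "g x"] by (fastforce simp: distrib_right)
  then show ?thesis using assms by (intro admissibleI) (auto simp: admissible_def)
qed

lemma admissible_mult [intro]:
  assumes "admissible f" and s: "s \<in> borel_measurable state_space" "\<And>x. \<bar>s x\<bar> \<le> d"
  shows "admissible (\<lambda>x. s x * f x)"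
proof -
  obtain c where c: "\<forall>x\<in>space state_space. \<bar>f x\<bar> \<le> c * wt x"
    using assms unfolding admissible_def by blast
  have "\<bar>s x * f x\<bar> \<le> (d * c) * wt x" if "x \<in> space state_space" for x
    using mult_mono[OF s(2)[of x] c[rule_format, OF that]] order_trans[OF abs_ge_zero s(2)[of x]]
    by (simp add: abs_mult mult_ac)
  then show ?thesis using assms by (intro admissibleI) (auto simp: admissible_def)
qed

lemma admissible_cmult [intro]: "admissible f \<Longrightarrow> admissible (\<lambda>x. a * f x)"
  by (rule admissible_mult[where d = "\<bar>a\<bar>"]) auto

lemma admissible_diff [intro]:
  assumes "admissible f" "admissible g" shows "admissible (\<lambda>x. f x - g x)"
  using admissible_add[OF assms(1) admissible_cmult[OF assms(2), of "-1"]] by simp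

lemma admissible_wt [intro]: "admissible wt"
  by (rule admissibleI[where c = 1]) (use wt_ge_1 order_trans[OF zero_le_one] in auto)

lemma admissible_cutw [intro]: "admissible (cutw K)"
  by (rule admissible_bounded[where c = "real K"]) (auto simp: cutw_nonneg cutw_le)

lemma (in jump_solution) integrable_admissible:
  "admissible f \<Longrightarrow> t \<in> {0..T} \<Longrightarrow> integrable (\<mu> t) f"
  unfolding admissible_def by (blast intro: integrable_le_wt)

section \<open>The difference of two solutions as a functional, and its total variation\<close>

locale two_solutions =
  mu: second_moment_solution R \<Lambda> T M \<mu> + nu: second_moment_solution R \<Lambda> T M \<nu>
  for R \<Lambda> T M \<mu> \<nu>
begin

definition diff :: "real \<Rightarrow> (real \<times> nat \<Rightarrow> real) \<Rightarrow> real" where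
  "diff t f = (\<integral>x. f x \<partial>\<mu> t) - (\<integral>x. f x \<partial>\<nu> t)"

definition sign :: "real \<Rightarrow> real \<times> nat \<Rightarrow> real" where
  "sign t = (SOME \<sigma>. hahn_sign (\<mu> t) (\<nu> t) \<sigma>)"

text \<open>Integral of f against the total variation of the difference at time t, written with the
  Hahn sign so that no signed measure has to be constructed.\<close>

definition tv :: "real \<Rightarrow> (real \<times> nat \<Rightarrow> real) \<Rightarrow> real" where
  "tv t f = diff t (\<lambda>x. sign t x * f x)"

lemma sg:
  assumes t: "t \<in> {0..T}"
  shows "hahn_sign (\<mu> t) (\<nu> t) (sign t)" "sign t \<in> borel_measurable state_space"
    "sign t x = 1 \<or> sign t x = -1" "\<bar>sign t x\<bar> = 1" "sign t x * sign t x = 1"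
proof -
  have "\<exists>\<sigma>. hahn_sign (\<mu> t) (\<nu> t) \<sigma>"
    using t by (intro hahn_sign_exists prob_space.finite_measure mu.\<mu>_prob nu.\<mu>_prob)
      (simp_all add: mu.sets_\<mu> nu.sets_\<mu>)
  then show h: "hahn_sign (\<mu> t) (\<nu> t) (sign t)" unfolding sign_def by (rule someI_ex)
  then show "sign t \<in> borel_measurable state_space"
    unfolding hahn_sign_def mu.measurable_\<mu>[OF t] by blast
  show s: "sign t x = 1 \<or> sign t x = -1" using h unfolding hahn_sign_def by blast
  then show "\<bar>sign t x\<bar> = 1" "sign t x * sign t x = 1" by auto
qed

lemma admissible_sg: "t \<in> {0..T} \<Longrightarrow> admissible f \<Longrightarrow> admissible (\<lambda>x. sign t x * f x)"
  by (rule admissible_mult[where d = 1]) (auto simp: sg)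

lemma diff_add:
  "t \<in> {0..T} \<Longrightarrow> admissible f \<Longrightarrow> admissible g \<Longrightarrow> diff t (\<lambda>x. f x + g x) = diff t f + diff t g"
  by (simp add: diff_def mu.integrable_admissible nu.integrable_admissible)

lemma diff_diff:
  "t \<in> {0..T} \<Longrightarrow> admissible f \<Longrightarrow> admissible g \<Longrightarrow> diff t (\<lambda>x. f x - g x) = diff t f - diff t g"
  by (simp add: diff_def mu.integrable_admissible nu.integrable_admissible)

lemma diff_cmult:
  "diff t (\<lambda>x. a * f x) = a * diff t f"
  by (simp add: diff_def right_diff_distrib)

lemma tv_add:
  assumes "t \<in> {0..T}" "admissible f" "admissible g"
  shows "tv t (\<lambda>x. f x + g x) = tv t f + tv t g"
  using diff_add[OF assms(1) admissible_sg admissible_sg] assms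
  by (simp add: tv_def distrib_left)

lemma tv_diff:
  assumes "t \<in> {0..T}" "admissible f" "admissible g"
  shows "tv t (\<lambda>x. f x - g x) = tv t f - tv t g"
  using diff_diff[OF assms(1) admissible_sg admissible_sg] assms
  by (simp add: tv_def right_diff_distrib)

lemma tv_cmult: "tv t (\<lambda>x. a * f x) = a * tv t f"
  using diff_cmult[of t a "\<lambda>x. sign t x * f x"] by (simp add: tv_def mult_ac)

lemma tv_nonneg:
  assumes t: "t \<in> {0..T}" and f: "admissible f" "\<And>x. x \<in> space state_space \<Longrightarrow> 0 \<le> f x"
  shows "0 \<le> tv t f"
proof -
  have "(\<integral>x. sign t x * f x \<partial>\<nu> t) \<le> (\<integral>x. sign t x * f x \<partial>\<mu> t)"
    using sg(1)[OF t] f t unfolding hahn_sign_def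
    by (simp add: mu.integrable_admissible nu.integrable_admissible mu.space_\<mu>)
  then show ?thesis by (simp add: tv_def diff_def)
qed

lemma tv_mono:
  assumes t: "t \<in> {0..T}" and f: "admissible f" "admissible g"
    and le: "\<And>x. x \<in> space state_space \<Longrightarrow> f x \<le> g x"
  shows "tv t f \<le> tv t g"
  using tv_nonneg[OF t admissible_diff[OF f(2,1)]] tv_diff[OF t f(2,1)] le by simp

text \<open>Since the sign squares to 1, \<open>diff t f\<close> equals \<open>tv t\<close> of sign
  times f, and \<open>tv\<close> is monotone; applying this to both signs of f gives the
  modulus.\<close>

lemma abs_diff_le_tv:
  assumes t: "t \<in> {0..T}" and f: "admissible f" "admissible g"
    and le: "\<And>x. x \<in> space state_space \<Longrightarrow> \<bar>f x\<bar> \<le> g x"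
  shows "\<bar>diff t f\<bar> \<le> tv t g"
proof -
  have eq: "diff t f = tv t (\<lambda>x. sign t x * f x)"
    using sg(5)[OF t] by (simp add: tv_def flip: mult.assoc)
  have sgle: "\<bar>sign t x * f x\<bar> \<le> g x" if "x \<in> space state_space" for x
    using le[OF that] sg(4)[OF t, of x] by (simp add: abs_mult)
  have "tv t (\<lambda>x. sign t x * f x) \<le> tv t g" "tv t (\<lambda>x. (-1) * (sign t x * f x)) \<le> tv t g"
    using sgle by (intro tv_mono t admissible_cmult admissible_sg f; fastforce)+
  then show ?thesis unfolding eq tv_cmult by linarith
qed

definition D :: "real \<Rightarrow> real" where "D t = tv t wt"

definition L :: real where "L = mu.lip + nu.lip"

lemma L_nonneg: "0 \<le> L"
  using mu.lip_nonneg nu.lip_nonneg by (simp add: L_def)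

lemma D_nonneg: "t \<in> {0..T} \<Longrightarrow> 0 \<le> D t"
  unfolding D_def using wt_ge_1 order_trans[OF zero_le_one] by (intro tv_nonneg) auto

lemma D_bound:
  assumes t: "t \<in> {0..T}"
  shows "D t \<le> 2 * (1 + M)"
proof -
  have a: "admissible (\<lambda>x. sign t x * wt x)" using t by (intro admissible_sg) auto
  have abs: "\<bar>sign t x * wt x\<bar> = wt x" for x
    using sg(4)[OF t, of x] wt_ge_1[of x] by (simp add: abs_mult)
  have "\<bar>\<integral>x. sign t x * wt x \<partial>\<mu> t\<bar> \<le> (\<integral>x. wt x \<partial>\<mu> t)"
    using integral_abs_bound[of "\<mu> t" "\<lambda>x. sign t x * wt x"] by (simp only: abs)
  moreover have "\<bar>\<integral>x. sign t x * wt x \<partial>\<nu> t\<bar> \<le> (\<integral>x. wt x \<partial>\<nu> t)"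
    using integral_abs_bound[of "\<nu> t" "\<lambda>x. sign t x * wt x"] by (simp only: abs)
  ultimately show ?thesis
    using mu.integrable_wt(2)[OF t] nu.integrable_wt(2)[OF t]
    by (simp add: D_def tv_def diff_def abs_le_iff)
qed

lemma diff_lipschitz:
  assumes m: "f \<in> borel_measurable state_space"
    and b: "\<And>x. x \<in> space state_space \<Longrightarrow> \<bar>f x\<bar> \<le> c * wt x"
    and t: "t \<in> {0..T}" "t' \<in> {0..T}"
  shows "\<bar>diff t' f - diff t f\<bar> \<le> c * L * \<bar>t' - t\<bar>"
  using mu.integral_lipschitz[OF m b t] nu.integral_lipschitz[OF m b t]
  by (simp add: diff_def L_def algebra_simps abs_le_iff)

text \<open>With the sign frozen at s, testing at s gives D s exactly and testing at t gives at most
  D t; both test the same function, so \<open>diff_lipschitz\<close> applies. Exchanging s and t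
  gives the other inequality.\<close>

lemma D_lipschitz:
  assumes "s \<in> {0..T}" "t \<in> {0..T}"
  shows "\<bar>D s - D t\<bar> \<le> L * \<bar>s - t\<bar>"
proof -
  have *: "D s \<le> D t + L * \<bar>s - t\<bar>" if s: "s \<in> {0..T}" and t: "t \<in> {0..T}" for s t
  proof -
    have le: "\<bar>sign s x * wt x\<bar> \<le> 1 * wt x" for x
      using sg(4)[OF s, of x] wt_ge_1[of x] by (simp add: abs_mult)
    have m: "(\<lambda>x. sign s x * wt x) \<in> borel_measurable state_space" using sg(2)[OF s] by simp
    have "\<bar>D s - diff t (\<lambda>x. sign s x * wt x)\<bar> \<le> 1 * L * \<bar>s - t\<bar>"
      unfolding D_def tv_def by (rule diff_lipschitz[OF m le t s])
    moreover have "\<bar>diff t (\<lambda>x. sign s x * wt x)\<bar> \<le> D t"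
      unfolding D_def using le s by (intro abs_diff_le_tv t admissible_sg admissible_wt) auto
    ultimately show ?thesis by (simp add: abs_le_iff)
  qed
  show ?thesis using *[OF assms] *[OF assms(2,1)] by (simp add: abs_le_iff abs_minus_commute)
qed

text \<open>At a state of level k the tent equals \<open>wt\<close> from K = 2 * k + 1 on, and
  \<open>wt\<close> is an integrable majorant; the sign stays that of time t.\<close>

lemma tv_cutw_tendsto:
  assumes t: "t \<in> {0..T}"
  shows "(\<lambda>K. tv t (cutw K)) \<longlonglongrightarrow> D t"
proof -
  have *: "(\<lambda>K. \<integral>x. sign t x * cutw K x \<partial>m) \<longlonglongrightarrow> (\<integral>x. sign t x * wt x \<partial>m)"
    if m: "borel_measurable m = (borel_measurable state_space :: (real \<times> nat \<Rightarrow> real) set)" "integrable m wt" for m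
  proof (rule integral_dominated_convergence[OF _ _ m(2)])
    show "AE x in m. (\<lambda>K. sign t x * cutw K x) \<longlonglongrightarrow> sign t x * wt x"
    proof (rule AE_I2)
      fix x :: "real \<times> nat"
      have "\<forall>\<^sub>F K in sequentially. cutw K x = wt x"
        by (rule eventually_sequentiallyI[of "2 * snd x + 1"]) (simp add: cutw_def wt_def)
      then show "(\<lambda>K. sign t x * cutw K x) \<longlonglongrightarrow> sign t x * wt x"
        by (intro tendsto_intros tendsto_eventually)
    qed
    show "AE x in m. norm (sign t x * cutw K x) \<le> wt x" for K
      using sg(4)[OF t] cutw_le(1) cutw_nonneg by (intro AE_I2) (simp add: abs_mult)
  qed (unfold m(1), (intro borel_measurable_times sg(2)[OF t] wt_measurable cutw_measurable)+)
  show ?thesis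
    unfolding D_def tv_def diff_def
    by (intro tendsto_diff * mu.measurable_\<mu> nu.measurable_\<mu> mu.integrable_wt nu.integrable_wt t)
qed

end

section \<open>One-step estimate and growth of the distance\<close>

context two_solutions
begin

lemma diff_increment_le:
  assumes m: "\<psi> \<in> borel_measurable state_space"
    and b: "\<And>x. x \<in> space state_space \<Longrightarrow> \<bar>\<psi> x\<bar> \<le> b"
    and t: "0 \<le> t" "0 \<le> h" "t + h \<le> T"
    and c: "\<And>s. s \<in> {t..t + h} \<Longrightarrow> mu.rate \<psi> s - nu.rate \<psi> s \<le> c"
  shows "diff (t + h) \<psi> \<le> diff t \<psi> + h * c"
proof -
  have t': "t \<le> t + h" using t by simp
  note i = mu.increment_eq[OF m b t(1) t' t(3)] nu.increment_eq[OF m b t(1) t' t(3)]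
  have "(LINT s:{t..t + h}|lborel. mu.rate \<psi> s - nu.rate \<psi> s) \<le> (LINT s:{t..t + h}|lborel. c)"
    by (rule set_integral_mono[OF set_integral_diff(1)[OF i(1,3)]])
      (use c t in \<open>auto simp: set_integrable_def emeasure_lborel_Icc_eq\<close>)
  then have "(LINT s:{t..t + h}|lborel. mu.rate \<psi> s) - (LINT s:{t..t + h}|lborel. nu.rate \<psi> s) \<le> h * c"
    using set_integral_diff(2)[OF i(1,3)] t by (simp add: set_lebesgue_integral_def)
  then show ?thesis using i(2,4) by (simp add: diff_def)
qed

text \<open>The factor 5 * \<Lambda> is that of \<open>kern_bound\<close>, whose quadratic weight is
  integrated against \<nu>.\<close>

definition C2 :: real where "C2 = 5 * \<Lambda> * nu.S2"

lemma C2_nonneg: "0 \<le> C2"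
proof -
  have "0 \<le> (\<integral>x. (wt x)\<^sup>2 \<partial>\<nu> 0)" by (rule integral_nonneg_AE) simp
  also have "\<dots> \<le> nu.S2"
    using nu.integrable_wt_sq(2)[of 0] mu.T_nonneg by simp
  finally show ?thesis using mu.\<Lambda>_nonneg by (simp add: C2_def)
qed

text \<open>The quadratic right-hand side is split as
  \<open>\<mu> \<otimes> \<mu> - \<nu> \<otimes> \<nu> = (\<mu> - \<nu>) \<otimes> \<mu> + \<nu> \<otimes> (\<mu> - \<nu>)\<close>; the time arguments of the first term are then
  frozen at \<open>t\<close>.\<close>

lemma rate_difference_le:
  assumes m: "\<psi> \<in> borel_measurable state_space"
    and b: "\<And>x. x \<in> space state_space \<Longrightarrow> \<bar>\<psi> x\<bar> \<le> cutw K x"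
    and ts: "t \<in> {0..T}" "s \<in> {0..T}"
  defines "c \<equiv> 5 * \<Lambda> * (1 + real K)\<^sup>2"
  shows "mu.rate \<psi> s - nu.rate \<psi> s \<le>
    diff t (mu.gen t \<psi>) + C2 * D t + (C2 * L + 3 * c * (1 + M) * L) * \<bar>s - t\<bar>"
proof -
  have c0: "0 \<le> c" using mu.\<Lambda>_nonneg by (simp add: c_def)
  have bw: "\<bar>\<psi> x\<bar> \<le> wt x" if "x \<in> space state_space" for x
    using b[OF that] cutw_le(1)[of K x] by linarith
  have bK: "\<bar>\<psi> x\<bar> \<le> real K" if "x \<in> space state_space" for x
    using b[OF that] cutw_le(2)[of K x] by linarith
  have km: "mu.kern \<psi> x \<in> borel_measurable state_space" if "x \<in> space state_space" for x
    using mu.kern_measurable[OF m measurable_const[OF that] measurable_ident] by simp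
  have kadm: "admissible (mu.kern \<psi> x)" if x: "x \<in> space state_space" for x
    by (rule admissibleI[OF km[OF x] mu.kern_cut_bound[OF b x]])
  have gm: "mu.gen r \<psi> \<in> borel_measurable state_space" "nu.gen r \<psi> \<in> borel_measurable state_space"
    if "r \<in> {0..T}" for r
    using that m by (auto intro: mu.gen_measurable nu.gen_measurable)
  have ga: "admissible (mu.gen r \<psi>)" "admissible (nu.gen r \<psi>)" if "r \<in> {0..T}" for r
    using that by (auto intro!: admissible_bounded gm mu.gen_cut_bound[OF b] nu.gen_cut_bound[OF b])
  have "mu.rate \<psi> s - nu.rate \<psi> s = (\<integral>x. mu.gen s \<psi> x \<partial>\<mu> s) - (\<integral>x. nu.gen s \<psi> x \<partial>\<nu> s)"
    using mu.rate_eq_gen[OF m bK ts(2)] nu.rate_eq_gen[OF m bK ts(2)] by simp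
  also have "\<dots> = diff s (mu.gen s \<psi>) + (\<integral>x. mu.gen s \<psi> x - nu.gen s \<psi> x \<partial>\<nu> s)"
    using ga[OF ts(2)] ts by (simp add: diff_def nu.integrable_admissible)
  finally have rate: "mu.rate \<psi> s - nu.rate \<psi> s =
    diff s (mu.gen s \<psi>) + (\<integral>x. mu.gen s \<psi> x - nu.gen s \<psi> x \<partial>\<nu> s)" .
  \<comment> \<open>For fixed x the integrand is the signed difference applied to
    \<open>mu.kern \<psi> x\<close>; it costs D s, and the remaining factor (wt x)^2 meets only
    \<open>\<nu> s\<close>.\<close>
  have "(\<integral>x. mu.gen s \<psi> x - nu.gen s \<psi> x \<partial>\<nu> s) \<le> (\<integral>x. 5 * \<Lambda> * D s * (wt x)\<^sup>2 \<partial>\<nu> s)"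
  proof (rule integral_mono)
    show "integrable (\<nu> s) (\<lambda>x. mu.gen s \<psi> x - nu.gen s \<psi> x)"
      using ga[OF ts(2)] ts by (simp add: nu.integrable_admissible)
    show "integrable (\<nu> s) (\<lambda>x. 5 * \<Lambda> * D s * (wt x)\<^sup>2)" using nu.integrable_wt_sq(1)[OF ts(2)] by simp
    fix x assume "x \<in> space (\<nu> s)"
    then have x: "x \<in> space state_space" using ts by (simp add: nu.space_\<mu>)
    have "mu.gen s \<psi> x - nu.gen s \<psi> x = diff s (mu.kern \<psi> x)"
      by (simp add: diff_def mu.gen_def nu.gen_def)
    also have "\<dots> \<le> tv s (\<lambda>y. 5 * \<Lambda> * (wt x)\<^sup>2 * wt y)"
      using abs_diff_le_tv[OF ts(2) kadm[OF x] admissible_cmult[OF admissible_wt] mu.kern_bound[OF bw x]]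
      by simp
    also have "\<dots> = 5 * \<Lambda> * D s * (wt x)\<^sup>2" unfolding tv_cmult D_def by simp
    finally show "mu.gen s \<psi> x - nu.gen s \<psi> x \<le> 5 * \<Lambda> * D s * (wt x)\<^sup>2" .
  qed
  also have "\<dots> \<le> C2 * D s"
    using nu.integrable_wt_sq(2)[OF ts(2)] D_nonneg[OF ts(2)] mu.\<Lambda>_nonneg
      mult_left_mono[of "\<integral>x. (wt x)\<^sup>2 \<partial>\<nu> s" nu.S2 "5 * \<Lambda> * D s"]
    by (simp add: C2_def mult_ac)
  also have "\<dots> \<le> C2 * (D t + L * \<bar>s - t\<bar>)"
    using D_lipschitz[OF ts(2,1)] C2_nonneg by (intro mult_left_mono) auto
  finally have I2: "(\<integral>x. mu.gen s \<psi> x - nu.gen s \<psi> x \<partial>\<nu> s) \<le> C2 * (D t + L * \<bar>s - t\<bar>)" .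
  \<comment> \<open>Moving s to t inside the generator costs twice c * (1 + M) * L * |s - t|, the 2
    coming from \<open>D_bound\<close>; moving it in the outer difference costs this once more,
    hence the factor 3 in the claim.\<close>
  have "\<bar>diff s (\<lambda>x. mu.gen s \<psi> x - mu.gen t \<psi> x)\<bar> \<le> tv s (\<lambda>x. c * L * \<bar>s - t\<bar> * wt x)"
  proof (rule abs_diff_le_tv[OF ts(2)])
    fix x assume x: "x \<in> space state_space"
    have "\<bar>mu.gen s \<psi> x - mu.gen t \<psi> x\<bar> \<le> c * mu.lip * \<bar>s - t\<bar>"
      unfolding mu.gen_def c_def by (rule mu.integral_lipschitz[OF km[OF x] mu.kern_cut_bound[OF b x] ts])
    also have "\<dots> \<le> c * L * \<bar>s - t\<bar>"
      using c0 nu.lip_nonneg by (intro mult_right_mono mult_left_mono) (auto simp: L_def)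
    also have "\<dots> \<le> c * L * \<bar>s - t\<bar> * wt x"
      using c0 L_nonneg wt_ge_1[of x] mult_left_mono[of 1 "wt x" "c * L * \<bar>s - t\<bar>"] by simp
    finally show "\<bar>mu.gen s \<psi> x - mu.gen t \<psi> x\<bar> \<le> c * L * \<bar>s - t\<bar> * wt x" .
  qed (use ga ts in auto)
  also have "\<dots> = c * L * \<bar>s - t\<bar> * D s" unfolding tv_cmult D_def ..
  also have "\<dots> \<le> c * L * \<bar>s - t\<bar> * (2 * (1 + M))"
    using D_bound[OF ts(2)] c0 L_nonneg by (intro mult_left_mono) auto
  finally have I3: "diff s (mu.gen s \<psi>) - diff s (mu.gen t \<psi>) \<le> c * L * \<bar>s - t\<bar> * (2 * (1 + M))"
    using diff_diff[OF ts(2) ga(1)[OF ts(2)] ga(1)[OF ts(1)]] by simp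
  have "\<bar>mu.gen t \<psi> x\<bar> \<le> c * (1 + M) * wt x" if x: "x \<in> space state_space" for x
    using mu.gen_cut_bound[OF b ts(1) x] c0 mu.M_pos wt_ge_1[of x]
      mult_left_mono[of 1 "wt x" "c * (1 + M)"] by (simp add: c_def)
  then have "\<bar>diff s (mu.gen t \<psi>) - diff t (mu.gen t \<psi>)\<bar> \<le> c * (1 + M) * L * \<bar>s - t\<bar>"
    by (intro diff_lipschitz gm ts)
  with rate I2 I3 show ?thesis by (simp add: algebra_simps)
qed

text \<open>\<psi> carries the sign of time t + h, so the left side is exactly
  \<open>diff (t + h) \<psi>\<close>; at time t its Euler step is estimated through a pointwise
  majorant alone, which is what \<open>euler_step_bound\<close> provides.\<close>

lemma tv_cutw_increment:
  assumes th: "0 \<le> t" "0 \<le> h" "t + h \<le> T" and h: "h * (mu.C1 * (1 + real K)) \<le> 1"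
  shows "tv (t + h) (cutw K) \<le> tv t (cutw K) + (mu.C1 + C2) * h * D t +
    (C2 * L + 3 * (5 * \<Lambda> * (1 + real K)\<^sup>2) * (1 + M) * L) * h\<^sup>2"
proof -
  define c where "c = C2 * L + 3 * (5 * \<Lambda> * (1 + real K)\<^sup>2) * (1 + M) * L"
  have c0: "0 \<le> c" using C2_nonneg L_nonneg mu.\<Lambda>_nonneg mu.M_pos by (simp add: c_def)
  have tT: "t \<in> {0..T}" and t'T: "t + h \<in> {0..T}" using th by auto
  define \<psi> where "\<psi> x = sign (t + h) x * cutw K x" for x
  have m: "\<psi> \<in> borel_measurable state_space"
    unfolding \<psi>_def[abs_def] using sg(2)[OF t'T] by measurable
  have b: "\<bar>\<psi> x\<bar> \<le> cutw K x" for x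
    using sg(4)[OF t'T, of x] cutw_nonneg[of K x] by (simp add: \<psi>_def abs_mult)
  have bK: "\<bar>\<psi> x\<bar> \<le> real K" for x using b[of x] cutw_le(2)[of K x] by linarith
  have \<psi>_adm: "admissible \<psi>" by (rule admissible_bounded[OF m bK])
  have g_adm: "admissible (mu.gen t \<psi>)"
    by (rule admissible_bounded[OF mu.gen_measurable[OF m tT] mu.gen_cut_bound[OF b tT]])
  have "diff (t + h) \<psi> \<le> diff t \<psi> + h * (diff t (mu.gen t \<psi>) + C2 * D t + c * h)"
  proof (rule diff_increment_le[OF m bK th])
    fix s assume s: "s \<in> {t..t + h}"
    then have "mu.rate \<psi> s - nu.rate \<psi> s \<le> diff t (mu.gen t \<psi>) + C2 * D t + c * \<bar>s - t\<bar>"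
      unfolding c_def using th by (intro rate_difference_le m b tT) auto
    also have "c * \<bar>s - t\<bar> \<le> c * h" using s c0 by (intro mult_left_mono) auto
    finally show "mu.rate \<psi> s - nu.rate \<psi> s \<le> diff t (mu.gen t \<psi>) + C2 * D t + c * h" by simp
  qed
  also have "\<dots> = diff t (\<lambda>x. \<psi> x + h * mu.gen t \<psi> x) + C2 * h * D t + c * h\<^sup>2"
    using diff_add[OF tT \<psi>_adm admissible_cmult[OF g_adm]]
    by (simp add: diff_cmult algebra_simps power2_eq_square)
  also have "diff t (\<lambda>x. \<psi> x + h * mu.gen t \<psi> x) \<le> tv t (\<lambda>x. cutw K x + h * mu.C1 * wt x)"
  proof -
    have "\<bar>diff t (\<lambda>x. \<psi> x + h * mu.gen t \<psi> x)\<bar> \<le> tv t (\<lambda>x. cutw K x + h * mu.C1 * wt x)"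
      by (intro abs_diff_le_tv tT admissible_add admissible_cmult \<psi>_adm g_adm admissible_cutw
          admissible_wt mu.euler_step_bound[OF b tT _ th(2) h])
    then show ?thesis by simp
  qed
  also have "\<dots> = tv t (cutw K) + h * mu.C1 * D t"
    unfolding D_def tv_cmult[symmetric]
    by (rule tv_add[OF tT admissible_cutw admissible_cmult[OF admissible_wt]])
  finally show ?thesis
    unfolding tv_def[of "t + h"] \<psi>_def[symmetric, abs_def] by (simp add: c_def algebra_simps)
qed

lemma D_growth:
  assumes "t \<in> {0..T}"
  shows "D t \<le> D 0 * exp ((mu.C1 + C2) * t)"
proof (rule gronwall_increments[where F = "\<lambda>K t. tv t (cutw K)", OF _ D_lipschitz _ tv_cutw_tendsto assms])
  show "0 \<le> mu.C1 + C2" using mu.C1_nonneg C2_nonneg by simp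
  fix K
  \<comment> \<open>The summand 1 keeps the step size 1 / (1 + C1 * (1 + K)) positive also when C1 =
    0.\<close>
  have pos: "0 < 1 + mu.C1 * (1 + real K)" using mu.C1_nonneg by (simp add: add_pos_nonneg)
  have small: "h * (mu.C1 * (1 + real K)) \<le> 1" if "0 \<le> h" "h \<le> inverse (1 + mu.C1 * (1 + real K))" for h
  proof -
    have "h * (1 + mu.C1 * (1 + real K)) \<le> 1" using that pos by (simp add: field_simps)
    then show ?thesis using that by (simp add: algebra_simps)
  qed
  show "\<exists>c h\<^sub>0. 0 < h\<^sub>0 \<and> (\<forall>t h. 0 \<le> t \<longrightarrow> 0 \<le> h \<longrightarrow> h \<le> h\<^sub>0 \<longrightarrow> t + h \<le> T \<longrightarrow>
    tv (t + h) (cutw K) \<le> tv t (cutw K) + (mu.C1 + C2) * h * D t + c * h\<^sup>2)"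
    using pos small
    by (intro exI[where P = "\<lambda>c. \<exists>h\<^sub>0. _ c h\<^sub>0" and x = "C2 * L + 3 * (5 * \<Lambda> * (1 + real K)\<^sup>2) * (1 + M) * L"]
        exI[where x = "inverse (1 + mu.C1 * (1 + real K))"] conjI allI impI tv_cutw_increment)
      simp_all
qed

section \<open>Identification of the distance with \<open>Theta\<close>\<close>

lemma diff_indicator:
  assumes t: "t \<in> {0..T}" and E: "E \<in> sets state_space"
  shows "diff t (indicator E) = measure (\<mu> t) E - measure (\<nu> t) E"
  using sets.sets_into_space[OF E] t
  by (simp add: diff_def mu.space_\<mu> nu.space_\<mu> Int_absorb2)

lemma admissible_indicator: "E \<in> sets state_space \<Longrightarrow> admissible (indicator E)"
  by (rule admissible_bounded[where c = 1]) (auto simp: indicator_def)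

text \<open>For \<le>, the difference on each piece is at most \<open>tv\<close> of its indicator,
  and \<open>tv\<close> is additive over the pieces. For \<ge>, the two parts of the slice on which
  the sign is 1 and -1 attain the value; \<open>B\<close> pads this partition with empty sets to a
  sequence.\<close>

lemma total_variation_slice:
  assumes t: "t \<in> {0..T}"
  shows "total_variation unit_borel (slice_diff (\<mu> t) (\<nu> t) k) {0..1} =
    ennreal (tv t (indicator ({0..1} \<times> {k})))"
    (is "?V = ennreal (tv t (indicator ?S))")
proof (rule antisym)
  have E: "A \<times> {k} \<in> sets state_space" if "A \<in> sets unit_borel" for A
    using that by (rule rectangle_in_state_space)
  have S: "?S \<in> sets state_space"
    by (rule E) (auto simp: sets_unit_borel)
  have slice: "slice_diff (\<mu> t) (\<nu> t) k A = diff t (indicator (A \<times> {k}))" if "A \<in> sets unit_borel" for A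
    using diff_indicator[OF t E[OF that]] by (simp add: slice_diff_def)
  have tv_ge: "\<bar>slice_diff (\<mu> t) (\<nu> t) k A\<bar> \<le> tv t (indicator (A \<times> {k}))" if "A \<in> sets unit_borel" for A
    unfolding slice[OF that]
    by (rule abs_diff_le_tv[OF t admissible_indicator admissible_indicator]) (use E[OF that] in \<open>auto simp: indicator_def\<close>)
  show "?V \<le> ennreal (tv t (indicator ?S))"
    unfolding total_variation_def
  proof (rule SUP_least)
    fix A :: "nat \<Rightarrow> real set"
    assume "A \<in> {A. range A \<subseteq> sets unit_borel \<and> disjoint_family A \<and> (\<Union>i. A i) = {0..1}}"
    then have A: "\<And>i. A i \<in> sets unit_borel" "disjoint_family A" "(\<Union>i. A i) = {0..1}" by auto
    have "(\<Sum>i<n. ennreal \<bar>slice_diff (\<mu> t) (\<nu> t) k (A i)\<bar>) \<le> ennreal (tv t (indicator ?S))" for n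
    proof -
      have un: "(\<Union>i<n. A i) \<in> sets unit_borel" for n using A(1) by auto
      have sum: "(\<Sum>i<n. tv t (indicator (A i \<times> {k}))) = tv t (indicator ((\<Union>i<n. A i) \<times> {k}))"
      proof (induction n)
        case 0
        have "tv t (\<lambda>_. 0) = 0" using tv_cmult[of t 0 wt] by simp
        then show ?case by (simp add: indicator_def)
      next
        case (Suc n)
        have "A n \<inter> A i = {}" if "i < n" for i
          using A(2) that by (intro disjoint_family_onD[of A UNIV]) auto
        then have "indicator ((\<Union>i<Suc n. A i) \<times> {k}) x =
            (indicator ((\<Union>i<n. A i) \<times> {k}) x + indicator (A n \<times> {k}) x :: real)" for x
          by (cases x) (auto simp: indicator_def less_Suc_eq)
        then have "(indicator ((\<Union>i<Suc n. A i) \<times> {k}) :: real \<times> nat \<Rightarrow> real) =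
            (\<lambda>x. indicator ((\<Union>i<n. A i) \<times> {k}) x + indicator (A n \<times> {k}) x)" by blast
        then show ?case
          using Suc tv_add[OF t admissible_indicator[OF E[OF un]] admissible_indicator[OF E[OF A(1)]]] by simp
      qed
      have "(\<Sum>i<n. ennreal \<bar>slice_diff (\<mu> t) (\<nu> t) k (A i)\<bar>) = ennreal (\<Sum>i<n. \<bar>slice_diff (\<mu> t) (\<nu> t) k (A i)\<bar>)"
        by (rule sum_ennreal) simp
      also have "\<dots> \<le> ennreal (\<Sum>i<n. tv t (indicator (A i \<times> {k})))"
        by (intro ennreal_leI sum_mono tv_ge A(1))
      also have "\<dots> \<le> ennreal (tv t (indicator ?S))"
        unfolding sum using A(3)
        by (intro ennreal_leI tv_mono t admissible_indicator E un S) (auto simp: indicator_def)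
      finally show ?thesis .
    qed
    then show "(\<Sum>i. ennreal \<bar>slice_diff (\<mu> t) (\<nu> t) k (A i)\<bar>) \<le> ennreal (tv t (indicator ?S))"
      by (intro suminf_le_const) auto
  qed
  define P where "P = {u \<in> {0..1}. sign t (u, k) = 1}"
  define B where "B i = (if i = 0 then P else if i = Suc 0 then {0..1} - P else {})" for i :: nat
  have P: "P \<in> sets unit_borel"
  proof -
    have "(\<lambda>u. sign t (u, k)) \<in> borel_measurable unit_borel"
      by (rule measurable_compose[OF _ sg(2)[OF t]]) (simp add: state_space_def)
    then have "{u \<in> space unit_borel. sign t (u, k) = 1} \<in> sets unit_borel" by measurable
    then show ?thesis by (simp add: P_def unit_borel_def)
  qed
  have P': "{0..1} - P \<in> sets unit_borel"
    using sets.compl_sets[OF P] by (simp add: unit_borel_def)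
  have B: "B \<in> {A. range A \<subseteq> sets unit_borel \<and> disjoint_family A \<and> (\<Union>i. A i) = {0..1}}"
  proof -
    have "(\<Union>i. B i) = B 0 \<union> B (Suc 0)" by (auto simp: B_def)
    then have "(\<Union>i. B i) = {0..1}" by (auto simp: B_def P_def)
    moreover have "disjoint_family B" by (auto simp: disjoint_family_on_def B_def)
    moreover have "range B \<subseteq> sets unit_borel" using P P' by (auto simp: B_def)
    ultimately show ?thesis by simp
  qed
  let ?d = "slice_diff (\<mu> t) (\<nu> t) k"
  have "sign t x * indicator ?S x = indicator (P \<times> {k}) x - indicator (({0..1} - P) \<times> {k}) x" for x
    using sg(3)[OF t, of x] by (cases x) (auto simp: indicator_def P_def)
  then have "tv t (indicator ?S) = ?d P - ?d ({0..1} - P)"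
    using diff_diff[OF t admissible_indicator[OF E[OF P]] admissible_indicator[OF E[OF P']]]
    by (simp add: tv_def slice P P')
  then have "ennreal (tv t (indicator ?S)) \<le> ennreal (\<bar>?d P\<bar> + \<bar>?d ({0..1} - P)\<bar>)"
    by (intro ennreal_leI) linarith
  also have "\<dots> = (\<Sum>i<2. ennreal \<bar>?d (B i)\<bar>)"
    by (simp add: B_def numeral_2_eq_2 lessThan_Suc add.commute flip: ennreal_plus)
  also have "\<dots> \<le> (\<Sum>i. ennreal \<bar>?d (B i)\<bar>)"
    by (rule sum_le_suminf) auto
  also have "\<dots> \<le> ?V"
    unfolding total_variation_def by (rule SUP_upper[OF B])
  finally show "ennreal (tv t (indicator ?S)) \<le> ?V" .
qed

text \<open>Additivity of \<open>tv\<close> collects the levels below n into the weight restricted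
  to these levels, and dominated convergence lets n grow. In particular \<Theta>(t) is
  finite.\<close>

lemma Theta_eq_D:
  assumes t: "t \<in> {0..T}"
  shows "Theta \<mu> \<nu> t = ennreal (D t)"
proof -
  define S where "S k = ({0..1} \<times> {k} :: (real \<times> nat) set)" for k
  have S: "S k \<in> sets state_space" for k
    unfolding S_def by (rule rectangle_in_state_space) (auto simp: sets_unit_borel)
  define w where "w n x = (if snd x < n then wt x else 0)" for n and x :: "real \<times> nat"
  have w: "w n \<in> borel_measurable state_space" for n unfolding w_def by measurable
  have w_adm: "admissible (w n)" for n
    by (rule admissibleI[OF w, of _ 1]) (use wt_ge_1 order_trans[OF zero_le_one] in \<open>auto simp: w_def\<close>)
  have sum: "(\<Sum>k<n. (1 + real k) * tv t (indicator (S k))) = tv t (w n)" for n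
  proof (induction n)
    case 0
    have "tv t (\<lambda>_. 0) = 0" using tv_cmult[of t 0 wt] by simp
    then show ?case by (simp add: w_def)
  next
    case (Suc n)
    have "tv t (\<lambda>x. w n x + (1 + real n) * indicator (S n) x) = tv t (w n) + (1 + real n) * tv t (indicator (S n))"
      unfolding tv_cmult[symmetric]
      by (rule tv_add[OF t w_adm admissible_cmult[OF admissible_indicator[OF S]]])
    \<comment> \<open>The two functions agree only on the carrier, hence monotonicity in both
      directions in place of an equality of functions.\<close>
    moreover have "tv t (w (Suc n)) = tv t (\<lambda>x. w n x + (1 + real n) * indicator (S n) x)"
      by (intro antisym tv_mono t w_adm admissible_add admissible_cmult[OF admissible_indicator[OF S]])
        (auto simp: w_def S_def wt_def indicator_def space_state_space less_Suc_eq)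
    ultimately show ?case using Suc by simp
  qed
  have lim: "(\<lambda>n. tv t (w n)) \<longlonglongrightarrow> D t"
  proof -
    have *: "(\<lambda>n. \<integral>x. sign t x * w n x \<partial>m) \<longlonglongrightarrow> (\<integral>x. sign t x * wt x \<partial>m)"
      if m: "borel_measurable m = (borel_measurable state_space :: (real \<times> nat \<Rightarrow> real) set)" "integrable m wt" for m
    proof (rule integral_dominated_convergence[OF _ _ m(2)])
      show "AE x in m. (\<lambda>n. sign t x * w n x) \<longlonglongrightarrow> sign t x * wt x"
      proof (rule AE_I2)
        fix x :: "real \<times> nat"
        have "\<forall>\<^sub>F n in sequentially. w n x = wt x"
          by (rule eventually_sequentiallyI[of "Suc (snd x)"]) (simp add: w_def)
        then show "(\<lambda>n. sign t x * w n x) \<longlonglongrightarrow> sign t x * wt x"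
          by (intro tendsto_intros tendsto_eventually)
      qed
      show "AE x in m. norm (sign t x * w n x) \<le> wt x" for n
        using sg(4)[OF t] wt_ge_1 order_trans[OF zero_le_one wt_ge_1] by (intro AE_I2) (simp add: abs_mult w_def)
    qed (unfold m(1), (intro borel_measurable_times sg(2)[OF t] wt_measurable w)+)
    show ?thesis
      unfolding D_def tv_def diff_def
      by (intro tendsto_diff * mu.measurable_\<mu> nu.measurable_\<mu> mu.integrable_wt nu.integrable_wt t)
  qed
  have nonneg: "0 \<le> tv t (indicator (S k))" for k
    by (rule tv_nonneg[OF t admissible_indicator[OF S]]) simp
  have "(\<lambda>k. (1 + real k) * tv t (indicator (S k))) sums D t"
    unfolding sums_def sum by (rule lim)
  then have "(\<Sum>k. ennreal ((1 + real k) * tv t (indicator (S k)))) = ennreal (D t)"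
    using nonneg by (intro suminf_ennreal_eq) auto
  then show ?thesis
    unfolding Theta_def total_variation_slice[OF t]
    using nonneg by (simp add: S_def ennreal_mult)
qed

text \<open>Every indicator is dominated by \<open>wt\<close>, so D t bounds the difference of the
  two measures on each measurable set.\<close>

lemma eq_if_D_eq_0:
  assumes t: "t \<in> {0..T}" and "D t = 0"
  shows "\<mu> t = \<nu> t"
proof (rule measure_eqI)
  show "sets (\<mu> t) = sets (\<nu> t)" using t by (simp add: mu.sets_\<mu> nu.sets_\<mu>)
  fix E assume "E \<in> sets (\<mu> t)"
  then have E: "E \<in> sets state_space" using t by (simp add: mu.sets_\<mu>)
  interpret M: prob_space "\<mu> t" using t by (rule mu.\<mu>_prob)
  interpret N: prob_space "\<nu> t" using t by (rule nu.\<mu>_prob)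
  have "\<bar>diff t (indicator E)\<bar> \<le> D t"
    unfolding D_def
    by (rule abs_diff_le_tv[OF t admissible_indicator[OF E] admissible_wt])
      (use wt_ge_1 order_trans[OF zero_le_one wt_ge_1] in \<open>auto simp: indicator_def\<close>)
  then show "emeasure (\<mu> t) E = emeasure (\<nu> t) E"
    using assms(2) diff_indicator[OF t E] by (simp add: M.emeasure_eq_measure N.emeasure_eq_measure)
qed

lemma Theta_growth:
  "(\<exists>C>0. \<forall>t\<in>{0..T}. Theta \<mu> \<nu> t \<le> ennreal (exp (C * t)) * Theta \<mu> \<nu> 0) \<and>
   (\<mu> 0 = \<nu> 0 \<longrightarrow> (\<forall>t\<in>{0..T}. \<mu> t = \<nu> t))"
proof (intro conjI impI ballI)
  have z: "0 \<in> {0..T}" using mu.T_nonneg by simp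
  \<comment> \<open>The summand 1 makes the constant strictly positive; C1 + C2 may be 0.\<close>
  have "Theta \<mu> \<nu> t \<le> ennreal (exp ((1 + mu.C1 + C2) * t)) * Theta \<mu> \<nu> 0" if t: "t \<in> {0..T}" for t
  proof -
    have "D t \<le> D 0 * exp ((mu.C1 + C2) * t)" by (rule D_growth[OF t])
    also have "\<dots> \<le> D 0 * exp ((1 + mu.C1 + C2) * t)"
      using D_nonneg[OF z] t by (intro mult_left_mono) (auto simp: algebra_simps)
    finally have "ennreal (D t) \<le> ennreal (D 0 * exp ((1 + mu.C1 + C2) * t))" by (rule ennreal_leI)
    then show ?thesis
      using D_nonneg[OF z] by (simp add: Theta_eq_D[OF t] Theta_eq_D[OF z] ennreal_mult mult.commute)
  qed
  then show "\<exists>C>0. \<forall>t\<in>{0..T}. Theta \<mu> \<nu> t \<le> ennreal (exp (C * t)) * Theta \<mu> \<nu> 0"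
    using mu.C1_nonneg C2_nonneg by (intro exI[of _ "1 + mu.C1 + C2"]) auto
  fix t assume eq: "\<mu> 0 = \<nu> 0" and t: "t \<in> {0..T}"
  have "D 0 = 0" using eq by (simp add: D_def tv_def diff_def)
  then have "D t = 0" using D_growth[OF t] D_nonneg[OF t] by simp
  then show "\<mu> t = \<nu> t" by (rule eq_if_D_eq_0[OF t])
qed

end

section \<open>From weak solutions to the abstract jump rates\<close>

theorem proposition3p2:
  fixes W :: "real \<Rightarrow> real \<Rightarrow> real" and c :: "nat \<Rightarrow> nat \<Rightarrow> real"
    and C\<^sub>c T M :: real and \<mu> \<nu> :: "real \<Rightarrow> (real \<times> nat) measure"
  assumes W_measurable: "(\<lambda>(u, v). W u v) \<in> borel_measurable (unit_borel \<Otimes>\<^sub>M unit_borel)"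
    and W_nonneg: "\<And>u v. u \<in> {0..1} \<Longrightarrow> v \<in> {0..1} \<Longrightarrow> 0 \<le> W u v"
    and W_bounded: "\<exists>B. \<forall>u \<in> {0..1}. \<forall>v \<in> {0..1}. W u v \<le> B"
    and c_nonneg: "\<And>k l. 0 \<le> c k l"
    and c_zero: "\<And>l. c 0 l = 0"
    and c_pos: "\<And>k l. 0 < k \<Longrightarrow> 0 < c k l"
    and C_c_pos: "0 < C\<^sub>c"
    and c_growth: "\<And>k l. c k l \<le> C\<^sub>c * real k * (1 + real l)"
    and T_pos: "0 < T"
    and sol_mu: "weak_solution W c T \<mu>"
    and sol_nu: "weak_solution W c T \<nu>"
    and first_moment_mu: "\<And>t. t \<in> {0..T} \<Longrightarrow> (\<integral>\<^sup>+ x. ennreal (real (snd x)) \<partial>\<mu> t) < ennreal M"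
    and first_moment_nu: "\<And>t. t \<in> {0..T} \<Longrightarrow> (\<integral>\<^sup>+ x. ennreal (real (snd x)) \<partial>\<nu> t) < ennreal M"
    and second_moment_mu: "(\<integral>\<^sup>+ x. ennreal ((real (snd x))\<^sup>2) \<partial>\<mu> 0) < \<infinity>"
    and second_moment_nu: "(\<integral>\<^sup>+ x. ennreal ((real (snd x))\<^sup>2) \<partial>\<nu> 0) < \<infinity>"
  shows "(\<exists>C\<^sub>T > 0. \<forall>t \<in> {0..T}. Theta \<mu> \<nu> t \<le> ennreal (exp (C\<^sub>T * t)) * Theta \<mu> \<nu> 0) \<and>
         (\<mu> 0 = \<nu> 0 \<longrightarrow> (\<forall>t \<in> {0..T}. \<mu> t = \<nu> t))"
proof -
  obtain B where B: "\<forall>u \<in> {0..1}. \<forall>v \<in> {0..1}. W u v \<le> B" using W_bounded by blast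
  have B0: "0 \<le> B" using B W_nonneg[of 0 0] by (metis atLeastAtMost_iff order_refl order_trans zero_le_one)
  define R where "R x y = W (fst x) (fst y) * c (snd x) (snd y)" for x y :: "real \<times> nat"
  \<comment> \<open>\<Lambda> is the product of the bound of W and the growth constant of c; the
    factor \<open>real k\<close> in the growth bound supplies the vanishing of \<open>R\<close> at
    level 0.\<close>
  interpret rates: jump_rates R "B * C\<^sub>c"
  proof
    have [measurable]: "case_prod W \<in> borel_measurable (unit_borel \<Otimes>\<^sub>M unit_borel)"
      using W_measurable by simp
    have "(\<lambda>z. case_prod W (fst (fst z), fst (snd z)) * c (snd (fst z)) (snd (snd z)))
        \<in> borel_measurable (state_space \<Otimes>\<^sub>M state_space)"
      by measurable
    then show "case_prod R \<in> borel_measurable (state_space \<Otimes>\<^sub>M state_space)"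
      by (simp add: R_def case_prod_unfold)
    fix x y assume x: "x \<in> space state_space" and y: "y \<in> space state_space"
    then have xy: "fst x \<in> {0..1}" "fst y \<in> {0..1}" by (auto simp: space_state_space)
    show "0 \<le> R x y" using xy by (simp add: R_def W_nonneg c_nonneg)
    show "R x y \<le> B * C\<^sub>c * real (snd x) * wt y"
      using mult_mono[OF B[rule_format, OF xy] c_growth[of "snd x" "snd y"] B0 c_nonneg]
      by (simp add: R_def wt_def mult.assoc)
  qed (use B0 C_c_pos in simp)
  have sol: "second_moment_solution R (B * C\<^sub>c) T M m"
    if m: "weak_solution W c T m" "\<And>t. t \<in> {0..T} \<Longrightarrow> (\<integral>\<^sup>+ x. ennreal (real (snd x)) \<partial>m t) < ennreal M"
      "(\<integral>\<^sup>+ x. ennreal ((real (snd x))\<^sup>2) \<partial>m 0) < \<infinity>" for m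
  proof (intro second_moment_solution.intro jump_solution.intro rates.jump_rates_axioms
      jump_solution_axioms.intro second_moment_solution_axioms.intro)
    have kernel: "m \<in> restrict_space borel {0..T} \<rightarrow>\<^sub>M prob_algebra state_space"
      using m(1) by (simp add: weak_solution_def)
    show "prob_space (m t)" "sets (m t) = sets state_space" if "t \<in> {0..T}" for t
      using measurable_space[OF kernel, of t] that by (auto simp: space_prob_algebra)
    show "set_integrable lborel {0..t}
          (\<lambda>s. \<integral>z. R (fst z) (snd z) * jump \<phi> (fst z) (snd z) \<partial>(m s \<Otimes>\<^sub>M m s)) \<and>
        (\<integral>x. \<phi> x \<partial>m t) = (\<integral>x. \<phi> x \<partial>m 0) + (LINT s:{0..t}|lborel.
          (\<integral>z. R (fst z) (snd z) * jump \<phi> (fst z) (snd z) \<partial>(m s \<Otimes>\<^sub>M m s)))"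
      if "\<phi> \<in> test_functions" "t \<in> {0..T}" for \<phi> t
    proof -
      have "rate_integrand W c \<phi> = (\<lambda>z. R (fst z) (snd z) * jump \<phi> (fst z) (snd z))"
        by (auto simp: rate_integrand_def R_def)
      then show ?thesis
        using m(1)[unfolded weak_solution_def, THEN conjunct2, rule_format, OF that] by simp
    qed
  qed (use m T_pos in auto)
  interpret two_solutions R "B * C\<^sub>c" T M \<mu> \<nu>
    by (intro two_solutions.intro sol sol_mu sol_nu first_moment_mu first_moment_nu
        second_moment_mu second_moment_nu)
  show ?thesis by (rule Theta_growth)
qed

end
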